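(* Let $d, m \in \mathbb{N}$ and let $A \subseteq \mathbb{R}^d$ be given by $$A=\{x \in \mathbb{R}^d : \Phi\bigl((\operatorname{sign} p_1(x) \in E_1),\ldots,(\operatorname{sign} p_m(x) \in E_m)\bigr)\},$$ where $\Phi$ is a boolean formula in $m$ boolean arguments, $p_1,\ldots,p_m \in \mathbb{R}[x]$, and $E_1,\ldots,E_m$ are non-empty subsets of $\{0,1\}$. Let $f \in \mathbb{R}[x]$ be a polynomial irreducible over $\mathbb{R}[x]$. Then the following statements hold. (I) $\operatorname{bd} A \subseteq \bigcup_{i=1}^m Z(p_i)$. (II) If $\dim(\operatorname{bd} A \cap Z(f)) = d-1$, then $f$ is a factor of $p_i$ for some $i \in \{1,\ldots,m\}$. (III) If there exist $a \in Z(f)$ and $\varepsilon>0$ such that $\dim(Z(f) \cap B^d(a,\varepsilon)) = d-1$ and $(f)_{\ge 0} \cap B^d(a,\varepsilon) = A \cap B^d(a,\varepsilon)$, then $\dim(\operatorname{bd} A \cap Z(f)) = d-1$ and, moreover, $f$ is an odd-multiplicity factor of $p_i$ for some $i \in \{1,\ldots,m\}$. (IV) If there exist $a \in Z(f)$ and $\varepsilon>0$ such that $\dim(Z(f) \cap B^d(a,\varepsilon)) = d-1$ and $(f)_{> 0} \cap B^d(a,\varepsilon) = A \cap B^d(a,\varepsilon)$, then $\dim(\operatorname{bd} A \cap Z(f)) = d-1$ and, moreover, $f$ is an odd-multiplicity factor of $p_i$ for some $i \in \{1,\ldots,m\}$.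
   Context: $\mathbb{R}[x]=\mathbb{R}[x_1,\ldots,x_d]$ is the ring of real polynomials in $d$ variables. For $f \in \mathbb{R}[x]$: $Z(f)=\{x\in\mathbb{R}^d: f(x)=0\}$, $(f)_{\ge 0}=\{x \in \mathbb{R}^d: f(x)\ge 0\}$, $(f)_{>0}=\{x \in \mathbb{R}^d: f(x)>0\}$. $B^d(c,\rho)$ is the open Euclidean ball in $\mathbb{R}^d$ with center $c$ and radius $\rho$; $\operatorname{bd}$ denotes the topological boundary in $\mathbb{R}^d$. $\operatorname{sign}$ takes values in $\{-1,0,1\}$. The dimension $\dim S$ of a semi-algebraic set $S\subseteq\mathbb{R}^d$ is the Krull dimension of the ring $\mathbb{R}[x]/\mathcal{I}(S)$, where $\mathcal{I}(S)=\{p\in\mathbb{R}[x]: p(x)=0 \text{ for all } x\in S\}$ (the usual semi-algebraic dimension, with the zero ring, i.e. $S=\emptyset$, having negative dimension). A polynomial is irreducible over $\mathbb{R}[x]$ if it is non-constant and is not a product of two non-constant polynomials in $\mathbb{R}[x]$. $p$ is a factor of $q$ if $q=pg$ for some $g\in\mathbb{R}[x]$. An irreducible factor $f$ of $p$ has multiplicity $k\in\mathbb{N}$ if $f^k$ is a factor of $p$ but $f^{k+1}$ is not; it is an odd-multiplicity factor if $k$ is odd. *)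

theory Defs
  imports
    "HOL-Analysis.Analysis"
    "HOL-Library.Poly_Mapping"
    "HOL-Library.Extended_Real"
    "HOL-Algebra.Ideal"
    "HOL-Algebra.QuotRing"
    "HOL-Algebra.Algebraic_Closure_Type"
begin

text \<open>
  The polynomial ring in the variables indexed by the finite type \<open>'n\<close>, so \<open>d = CARD('n)\<close>:
  finitely supported maps from exponent vectors to coefficients, with the convolution product
  of \<^theory>\<open>HOL-Library.Poly_Mapping\<close>.
\<close>

type_synonym 'n rpoly = "('n \<Rightarrow>\<^sub>0 nat) \<Rightarrow>\<^sub>0 real"

definition mpoly_eval :: "'n::finite rpoly \<Rightarrow> real ^ 'n \<Rightarrow> real" where
  "mpoly_eval p x = (\<Sum>t\<in>Poly_Mapping.keys p.
     Poly_Mapping.lookup p t * (\<Prod>i\<in>UNIV. (x $ i) ^ Poly_Mapping.lookup t i))"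

definition zero_set :: "'n::finite rpoly \<Rightarrow> (real ^ 'n) set" where
  "zero_set f = {x. mpoly_eval f x = 0}"

definition nonneg_set :: "'n::finite rpoly \<Rightarrow> (real ^ 'n) set" where
  "nonneg_set f = {x. mpoly_eval f x \<ge> 0}"

definition pos_set :: "'n::finite rpoly \<Rightarrow> (real ^ 'n) set" where
  "pos_set f = {x. mpoly_eval f x > 0}"

definition constant_poly :: "'n rpoly \<Rightarrow> bool" where
  "constant_poly p \<longleftrightarrow> (\<exists>c. p = Poly_Mapping.single 0 c)"

definition irreducible_poly :: "'n rpoly \<Rightarrow> bool" where
  "irreducible_poly f \<longleftrightarrow> \<not> constant_poly f \<and>
     \<not> (\<exists>g h. \<not> constant_poly g \<and> \<not> constant_poly h \<and> f = g * h)"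

definition has_multiplicity :: "'n rpoly \<Rightarrow> 'n rpoly \<Rightarrow> nat \<Rightarrow> bool" where
  "has_multiplicity f p k \<longleftrightarrow> f ^ k dvd p \<and> \<not> f ^ (k + 1) dvd p"

text \<open>No multiplicity is assigned with respect to \<open>p = 0\<close>.\<close>

definition odd_multiplicity_factor :: "'n rpoly \<Rightarrow> 'n rpoly \<Rightarrow> bool" where
  "odd_multiplicity_factor f p \<longleftrightarrow>
     irreducible_poly f \<and> f dvd p \<and> (\<exists>k. odd k \<and> has_multiplicity f p k)"

definition vanishing_ideal :: "(real ^ 'n::finite) set \<Rightarrow> 'n rpoly set" where
  "vanishing_ideal S = {p. \<forall>x\<in>S. mpoly_eval p x = 0}"

text \<open>
  The supremum of the lengths \<open>n\<close> of chains \<open>P 0 \<subset> \<dots> \<subset> P n\<close> of prime ideals. The zero ring has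
  no prime ideals, so its dimension is \<open>Sup {} = -\<infinity>\<close>.
\<close>

definition krull_dim :: "('a, 'b) ring_scheme \<Rightarrow> ereal" where
  "krull_dim R = Sup {ereal (real n) | n.
     \<exists>P. (\<forall>i\<le>n. primeideal (P i) R) \<and> (\<forall>i<n. P i \<subset> P (Suc i))}"

definition sa_dim :: "(real ^ 'n::finite) set \<Rightarrow> ereal" where
  "sa_dim S = krull_dim ((ring_of_type_algebra :: 'n rpoly ring) Quot vanishing_ideal S)"

datatype bool_formula =
    BTrue
  | BVar nat
  | BNot bool_formula
  | BAnd bool_formula bool_formula
  | BOr bool_formula bool_formula

primrec bf_vars :: "bool_formula \<Rightarrow> nat set" where
  "bf_vars BTrue = {}"
| "bf_vars (BVar i) = {i}"
| "bf_vars (BNot \<phi>) = bf_vars \<phi>"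
| "bf_vars (BAnd \<phi> \<psi>) = bf_vars \<phi> \<union> bf_vars \<psi>"
| "bf_vars (BOr \<phi> \<psi>) = bf_vars \<phi> \<union> bf_vars \<psi>"

primrec bf_holds :: "bool_formula \<Rightarrow> (nat \<Rightarrow> bool) \<Rightarrow> bool" where
  "bf_holds BTrue v \<longleftrightarrow> True"
| "bf_holds (BVar i) v \<longleftrightarrow> v i"
| "bf_holds (BNot \<phi>) v \<longleftrightarrow> \<not> bf_holds \<phi> v"
| "bf_holds (BAnd \<phi> \<psi>) v \<longleftrightarrow> bf_holds \<phi> v \<and> bf_holds \<psi> v"
| "bf_holds (BOr \<phi> \<psi>) v \<longleftrightarrow> bf_holds \<phi> v \<or> bf_holds \<psi> v"

end

theory Submission
  imports Defs
begin

text \<open>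
  A sign condition can change only where one of the \<open>p i\<close> vanishes, which is the first claim. For
  the other three, everything rests on one fact (\<open>vanishing_ideal_of_codim_1\<close>): if \<open>f\<close> is
  irreducible and \<open>S \<subseteq> Z(f)\<close> has dimension \<open>d - 1\<close>, then the polynomials vanishing on \<open>S\<close> are
  exactly the multiples of \<open>f\<close>.

  To see this, note that \<open>(f)\<close> is prime because the polynomial ring is factorial. If the ideal of \<open>S\<close>
  were strictly larger than \<open>(f)\<close>, then a chain of \<open>d\<close> primes above it, which exists as \<open>S\<close> has
  dimension \<open>d - 1\<close>, could be prolonged at the bottom by \<open>(f)\<close> and \<open>0\<close> to a chain of \<open>d + 2\<close> primes.
  Such a chain does not exist (\<open>prime_chain_bound\<close>): choosing an element from each step gives
  \<open>d + 1\<close> polynomials in \<open>d\<close> variables. They satisfy a polynomial relation, because they have more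
  monomials of bounded degree than a space of polynomials of bounded degree has dimensions; and the
  lexicographically least monomial of the relation contradicts the choice of the elements. Factoriality
  is Gauss's lemma, proved for polynomials with coefficients in a subring and applied to one variable
  after another, so that the induction stays inside a single type.

  The second claim follows at once: the product of the \<open>p i\<close> vanishes on \<open>bd A\<close>, hence is a
  multiple of the prime \<open>f\<close>. For the last two claims, let \<open>g\<close> be a nonzero partial derivative of \<open>f\<close>;
  for degree reasons \<open>f\<close> does not divide \<open>g\<close>. At a zero of \<open>f\<close> inside the given ball where \<open>g\<close> does
  not vanish, \<open>f\<close> takes both signs arbitrarily close by, so the point lies in \<open>bd A\<close>. If \<open>h\<close> vanishes
  on \<open>bd A \<inter> Z(f)\<close>, then \<open>h * g\<close> vanishes on \<open>Z(f)\<close> inside the ball, so \<open>f\<close> divides \<open>h * g\<close> and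
  therefore \<open>h\<close>. Thus \<open>bd A \<inter> Z(f)\<close> and the piece of \<open>Z(f)\<close> in the ball have the same ideal \<open>(f)\<close>
  and the same dimension. If \<open>f\<close> had even multiplicity in every nonzero \<open>p i\<close>, write
  \<open>p i = f\<^sup>2\<^sup>k * q i\<close> with \<open>f\<close> not dividing \<open>q i\<close>. Some zero of \<open>f\<close> in the ball is a zero neither of
  \<open>g\<close> nor of any \<open>q i\<close>. Near it, each \<open>p i\<close> has the same sign where \<open>f > 0\<close> and where
  \<open>f < 0\<close>, so \<open>A\<close> could not separate these two sides.
\<close>

(* Below, degree, coefficients and monomials are those of univariate polynomials of type poly. *)
hide_const (open) Polynomials.degree Polynomials.lead_coeff up_ring.coeff up_ring.monom module.smult

section \<open>Gauss's lemma over a subring\<close>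

text \<open>
  Divisibility inside the subset \<open>R\<close> of a ring: the cofactor is required to lie in \<open>R\<close>, which the
  divisibility of the ambient type does not see.
\<close>

definition dvd_in :: "'a::comm_ring_1 set \<Rightarrow> 'a \<Rightarrow> 'a \<Rightarrow> bool" where
  "dvd_in R a b \<longleftrightarrow> (\<exists>c\<in>R. b = a * c)"

text \<open>
  The norm \<open>N\<close> is meant to be additive and zero exactly on the units; the last clause then says that one
  of the two factors is a unit.
\<close>

definition irreducible_in :: "'a::comm_ring_1 set \<Rightarrow> ('a \<Rightarrow> nat) \<Rightarrow> 'a \<Rightarrow> bool" where
  "irreducible_in R N q \<longleftrightarrow> q \<in> R \<and> q \<noteq> 0 \<and> N q \<noteq> 0 \<and>
     (\<forall>a\<in>R. \<forall>b\<in>R. q = a * b \<longrightarrow> N a = 0 \<or> N b = 0)"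

text \<open>
  A factorial domain presented as a subset of a commutative ring type that may itself have zero
  divisors. Carriers are sets because the number of variables grows in the induction below, which
  types cannot follow. The additive norm provides the existence of factorizations by induction on
  its value, and passes to polynomials as the degree plus the norm of the leading coefficient.
\<close>

locale normed_ufd =
  fixes R :: "'a::comm_ring_1 set" and N :: "'a \<Rightarrow> nat"
  assumes zero_closed [simp]: "0 \<in> R"
    and one_closed [simp]: "1 \<in> R"
    and add_closed [simp]: "a \<in> R \<Longrightarrow> b \<in> R \<Longrightarrow> a + b \<in> R"
    and uminus_closed [simp]: "a \<in> R \<Longrightarrow> - a \<in> R"
    and mult_closed [simp]: "a \<in> R \<Longrightarrow> b \<in> R \<Longrightarrow> a * b \<in> R"
    and no_zero_div: "a \<in> R \<Longrightarrow> b \<in> R \<Longrightarrow> a * b = 0 \<Longrightarrow> a = 0 \<or> b = 0"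
    and norm_mult: "a \<in> R \<Longrightarrow> b \<in> R \<Longrightarrow> a \<noteq> 0 \<Longrightarrow> b \<noteq> 0 \<Longrightarrow> N (a * b) = N a + N b"
    and norm_0_unit: "a \<in> R \<Longrightarrow> a \<noteq> 0 \<Longrightarrow> N a = 0 \<Longrightarrow> \<exists>b\<in>R. a * b = 1"
    and irreducible_prime: "irreducible_in R N q \<Longrightarrow> a \<in> R \<Longrightarrow> b \<in> R \<Longrightarrow> dvd_in R q (a * b)
          \<Longrightarrow> dvd_in R q a \<or> dvd_in R q b"
begin

lemma diff_closed [simp]: "a \<in> R \<Longrightarrow> b \<in> R \<Longrightarrow> a - b \<in> R"
  using add_closed[of a "- b"] by simp

lemma cancel_left: "a \<in> R \<Longrightarrow> b \<in> R \<Longrightarrow> c \<in> R \<Longrightarrow> a \<noteq> 0 \<Longrightarrow> a * b = a * c \<Longrightarrow> b = c"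
  using no_zero_div[of a "b - c"] by (auto simp: algebra_simps)

lemma dvd_in_add: "dvd_in R q a \<Longrightarrow> dvd_in R q b \<Longrightarrow> dvd_in R q (a + b)"
  unfolding dvd_in_def by (metis add_closed distrib_left)

lemma dvd_in_diff: "dvd_in R q a \<Longrightarrow> dvd_in R q b \<Longrightarrow> dvd_in R q (a - b)"
  unfolding dvd_in_def by (metis diff_closed right_diff_distrib)

lemma dvd_in_mult: "dvd_in R q a \<Longrightarrow> b \<in> R \<Longrightarrow> dvd_in R q (a * b)"
  unfolding dvd_in_def by (metis mult.assoc mult_closed)

lemma dvd_in_0: "dvd_in R q 0"
  unfolding dvd_in_def by (intro bexI[of _ 0]) auto

lemma dvd_in_sum: "(\<And>i. i \<in> I \<Longrightarrow> dvd_in R q (h i)) \<Longrightarrow> dvd_in R q (sum h I)"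
proof (induction I rule: infinite_finite_induct)
  case (insert x F)
  then show ?case by (auto intro!: dvd_in_add)
qed (auto simp: dvd_in_0)

lemma irreducible_factor:
  assumes "a \<in> R" "a \<noteq> 0" "N a \<noteq> 0"
  shows "\<exists>q b. irreducible_in R N q \<and> b \<in> R \<and> a = q * b"
  using assms
proof (induction "N a" arbitrary: a rule: less_induct)
  case less
  show ?case
  proof (cases "irreducible_in R N a")
    case True
    then show ?thesis by (intro exI[of _ a] exI[of _ 1]) auto
  next
    case False
    then obtain b c where bc: "b \<in> R" "c \<in> R" "a = b * c" "N b \<noteq> 0" "N c \<noteq> 0"
      using less.prems unfolding irreducible_in_def by auto
    have nz: "b \<noteq> 0" "c \<noteq> 0" using bc less.prems by auto
    then have "N b < N a" using bc norm_mult by simp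
    then obtain q e where "irreducible_in R N q" "e \<in> R" "b = q * e"
      using less.hyps[of b] bc nz by blast
    then show ?thesis using bc by (metis mult.assoc mult_closed)
  qed
qed

lemma factor_induct [consumes 2, case_names unit irred]:
  assumes "a \<in> R" "a \<noteq> 0"
    and unit: "\<And>a b. a \<in> R \<Longrightarrow> b \<in> R \<Longrightarrow> a * b = 1 \<Longrightarrow> P a"
    and irred: "\<And>q a. irreducible_in R N q \<Longrightarrow> a \<in> R \<Longrightarrow> a \<noteq> 0 \<Longrightarrow> P a \<Longrightarrow> P (q * a)"
  shows "P a"
  using assms(1,2)
proof (induction "N a" arbitrary: a rule: less_induct)
  case less
  show ?case
  proof (cases "N a = 0")
    case True
    then show ?thesis using norm_0_unit less.prems unit by blast
  next
    case False
    then obtain q b where qb: "irreducible_in R N q" "b \<in> R" "a = q * b"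
      using irreducible_factor less.prems by blast
    then have q: "q \<in> R" "q \<noteq> 0" "N q \<noteq> 0" by (auto simp: irreducible_in_def)
    have "b \<noteq> 0" using qb less.prems by auto
    then have "N b < N a" using qb q norm_mult by simp
    then show ?thesis using less.hyps \<open>b \<noteq> 0\<close> qb irred by blast
  qed
qed

lemma norm_one [simp]: "N 1 = 0"
proof -
  have "N (1 * 1) = N 1 + N 1" by (rule norm_mult) auto
  then have "N 1 = N 1 + N 1" by (simp only: mult_1_left)
  then show ?thesis by arith
qed

lemma unit_norm_0: "a \<in> R \<Longrightarrow> b \<in> R \<Longrightarrow> a * b = 1 \<Longrightarrow> N a = 0"
  using norm_mult[of a b] norm_one by (metis add_is_0 mult_zero_left mult_zero_right zero_neq_one)

end

definition polys_over :: "'a::comm_ring_1 set \<Rightarrow> 'a poly set" where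
  "polys_over R = {p. \<forall>i. coeff p i \<in> R}"

definition poly_norm :: "('a::comm_ring_1 \<Rightarrow> nat) \<Rightarrow> 'a poly \<Rightarrow> nat" where
  "poly_norm N p = degree p + N (lead_coeff p)"

lemma polys_overI: "(\<And>i. coeff p i \<in> R) \<Longrightarrow> p \<in> polys_over R"
  by (simp add: polys_over_def)

context normed_ufd
begin

abbreviation PR where "PR \<equiv> polys_over R"
abbreviation PN where "PN \<equiv> poly_norm N"

lemma coeff_in [simp]: "p \<in> PR \<Longrightarrow> coeff p i \<in> R"
  by (simp add: polys_over_def)

lemma PR_zero [simp]: "0 \<in> PR" and PR_one [simp]: "1 \<in> PR"
  by (auto intro!: polys_overI simp: of_bool_def)

lemma PR_add [simp]: "p \<in> PR \<Longrightarrow> q \<in> PR \<Longrightarrow> p + q \<in> PR"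
  and PR_uminus [simp]: "p \<in> PR \<Longrightarrow> - p \<in> PR"
  and PR_diff [simp]: "p \<in> PR \<Longrightarrow> q \<in> PR \<Longrightarrow> p - q \<in> PR"
  and PR_smult [simp]: "c \<in> R \<Longrightarrow> p \<in> PR \<Longrightarrow> smult c p \<in> PR"
  by (auto intro!: polys_overI)

lemma PR_mult [simp]: "p \<in> PR \<Longrightarrow> q \<in> PR \<Longrightarrow> p * q \<in> PR"
  by (intro polys_overI coeff_mult_semiring_closed) auto

lemma PR_const [simp]: "[:c:] \<in> PR \<longleftrightarrow> c \<in> R"
  using coeff_in[of "[:c:]" 0] by (auto intro!: polys_overI simp: coeff_pCons split: nat.splits)

lemma PR_monom [simp]: "c \<in> R \<Longrightarrow> monom c n \<in> PR"
  by (auto intro!: polys_overI)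

lemma lead_coeff_mult_neq_0:
  assumes "p \<in> PR" "q \<in> PR" "p \<noteq> 0" "q \<noteq> 0"
  shows "lead_coeff p * lead_coeff q \<noteq> 0"
  using no_zero_div[of "lead_coeff p" "lead_coeff q"] assms by auto

lemma degree_mult_PR:
  assumes "p \<in> PR" "q \<in> PR" "p \<noteq> 0" "q \<noteq> 0"
  shows "degree (p * q) = degree p + degree q"
proof (rule antisym)
  show "degree (p * q) \<le> degree p + degree q" by (rule degree_mult_le)
  show "degree p + degree q \<le> degree (p * q)"
    using lead_coeff_mult_neq_0[OF assms] by (intro le_degree) (simp only: coeff_mult_degree_sum not_False_eq_True)
qed

lemma lead_coeff_mult_PR:
  assumes "p \<in> PR" "q \<in> PR" "p \<noteq> 0" "q \<noteq> 0"
  shows "lead_coeff (p * q) = lead_coeff p * lead_coeff q"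
  by (simp only: degree_mult_PR[OF assms] coeff_mult_degree_sum)

lemma PR_no_zero_div: "p \<in> PR \<Longrightarrow> q \<in> PR \<Longrightarrow> p * q = 0 \<Longrightarrow> p = 0 \<or> q = 0"
  by (metis coeff_0 coeff_mult_degree_sum lead_coeff_mult_neq_0)

lemma PN_mult:
  assumes "p \<in> PR" "q \<in> PR" "p \<noteq> 0" "q \<noteq> 0"
  shows "PN (p * q) = PN p + PN q"
proof -
  have "N (lead_coeff p * lead_coeff q) = N (lead_coeff p) + N (lead_coeff q)"
    using assms by (intro norm_mult) auto
  then have "N (lead_coeff (p * q)) = N (lead_coeff p) + N (lead_coeff q)"
    by (simp only: lead_coeff_mult_PR[OF assms])
  then show ?thesis unfolding poly_norm_def using degree_mult_PR[OF assms] by linarith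
qed

lemma PN_const [simp]: "PN [:c:] = N c"
  by (simp add: poly_norm_def)

lemma PN_0_unit:
  assumes "p \<in> PR" "p \<noteq> 0" "PN p = 0"
  shows "\<exists>q\<in>PR. p * q = 1"
proof -
  have d: "degree p = 0" using assms by (simp add: poly_norm_def)
  then obtain c where c: "p = [:c:]" by (metis degree_eq_zeroE)
  then have "c \<in> R" "c \<noteq> 0" "N c = 0" using assms by auto
  then obtain b where "b \<in> R" "c * b = 1" using norm_0_unit by blast
  then show ?thesis using c by (intro bexI[of _ "[:b:]"]) (auto simp: one_pCons mult.commute)
qed

lemma smult_cancel_PR:
  assumes "p \<in> PR" "q \<in> PR" "c \<in> R" "c \<noteq> 0" "smult c p = smult c q"
  shows "p = q"
proof (rule poly_eqI)
  fix i
  have "c * coeff p i = c * coeff q i" using assms(5) by (metis coeff_smult)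
  then show "coeff p i = coeff q i" using cancel_left[of c] assms by auto
qed

lemma degree_smult_PR: "p \<in> PR \<Longrightarrow> c \<in> R \<Longrightarrow> c \<noteq> 0 \<Longrightarrow> degree (smult c p) = degree p"
  using degree_mult_PR[of "[:c:]" p] by (cases "p = 0") auto

lemma const_dvd_iff:
  assumes "p \<in> PR"
  shows "(\<exists>r\<in>PR. p = smult c r) \<longleftrightarrow> (\<forall>i. dvd_in R c (coeff p i))"
proof
  assume "\<forall>i. dvd_in R c (coeff p i)"
  then obtain h where h: "\<And>i. h i \<in> R" "\<And>i. coeff p i = c * h i"
    unfolding dvd_in_def by metis
  define r where "r = Poly (map h [0..<Suc (degree p)])"
  have cr: "coeff r i = (if i \<le> degree p then h i else 0)" for i
    by (simp add: r_def nth_default_def del: upt_Suc)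
  have "r \<in> PR" by (auto intro!: polys_overI simp: cr h)
  moreover have "p = smult c r"
    by (rule poly_eqI) (auto simp: cr h(2)[symmetric] coeff_eq_0)
  ultimately show "\<exists>r\<in>PR. p = smult c r" by blast
qed (auto simp: dvd_in_def)

text \<open>
  A prime of \<open>R\<close> stays prime in the polynomials over \<open>R\<close>: if it divides neither factor, let \<open>i\<close>
  and \<open>j\<close> be the least indices of coefficients it does not divide. In the coefficient \<open>i + j\<close> of
  the product, all summands but one are then divisible by it.
\<close>

lemma const_prime:
  assumes q: "irreducible_in R N q" and f: "f \<in> PR" and g: "g \<in> PR" and h: "h \<in> PR"
    and eq: "f * g = smult q h"
  shows "(\<exists>r\<in>PR. f = smult q r) \<or> (\<exists>r\<in>PR. g = smult q r)"
proof (rule ccontr)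
  assume neg: "\<not> ?thesis"
  define Df where "Df i \<longleftrightarrow> \<not> dvd_in R q (coeff f i)" for i
  define Dg where "Dg i \<longleftrightarrow> \<not> dvd_in R q (coeff g i)" for i
  have "\<exists>i. Df i" "\<exists>j. Dg j" using neg const_dvd_iff[OF f] const_dvd_iff[OF g] by (auto simp: Df_def Dg_def)
  then obtain i j where i: "Df i" "\<And>k. k < i \<Longrightarrow> \<not> Df k" and j: "Dg j" "\<And>k. k < j \<Longrightarrow> \<not> Dg k"
    by (metis LeastI_ex not_less_Least)
  have "coeff (f * g) (i + j) = (\<Sum>k\<le>i+j. coeff f k * coeff g (i + j - k))"
    by (rule coeff_mult)
  also have "\<dots> = coeff f i * coeff g j + (\<Sum>k\<in>{..i+j} - {i}. coeff f k * coeff g (i + j - k))"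
    by (subst sum.remove[of _ i]) auto
  finally have e: "coeff f i * coeff g j
      = coeff (f * g) (i + j) - (\<Sum>k\<in>{..i+j} - {i}. coeff f k * coeff g (i + j - k))"
    by simp
  have "dvd_in R q (coeff f i * coeff g j)" unfolding e
  proof (intro dvd_in_diff dvd_in_sum)
    show "dvd_in R q (coeff (f * g) (i + j))" using h unfolding eq dvd_in_def by auto
    fix k assume k: "k \<in> {..i+j} - {i}"
    show "dvd_in R q (coeff f k * coeff g (i + j - k))"
    proof (cases "k < i")
      case True
      then show ?thesis using i(2) g by (auto simp: Df_def intro: dvd_in_mult)
    next
      case False
      then have "i + j - k < j" using k by auto
      then show ?thesis using j(2) f dvd_in_mult[of q "coeff g (i + j - k)" "coeff f k"]
        by (auto simp: Dg_def mult.commute)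
    qed
  qed
  then show False using irreducible_prime[OF q coeff_in[OF f] coeff_in[OF g]] i(1) j(1) by (auto simp: Df_def Dg_def)
qed

text \<open>
  Division with remainder after multiplication by a nonzero constant, which replaces division over
  the field of fractions of \<open>R\<close>.
\<close>

lemma pseudo_division:
  assumes "p \<in> PR" "r \<in> PR" "r \<noteq> 0"
  shows "\<exists>c q t. c \<in> R \<and> c \<noteq> 0 \<and> q \<in> PR \<and> t \<in> PR \<and> smult c p = q * r + t \<and> (t = 0 \<or> degree t < degree r)"
  using assms(1)
proof (induction "degree p" arbitrary: p rule: less_induct)
  case less
  show ?case
  proof (cases "p = 0 \<or> degree p < degree r")
    case True
    then show ?thesis using less.prems by (intro exI[of _ 1] exI[of _ 0] exI[of _ p]) auto
  next
    case False
    define m where "m = monom (lead_coeff p) (degree p - degree r)"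
    define p' where "p' = smult (lead_coeff r) p - m * r"
    have lr: "lead_coeff r \<in> R" "lead_coeff r \<noteq> 0" using assms by auto
    have m: "m \<in> PR" "m \<noteq> 0" "degree m = degree p - degree r" "lead_coeff m = lead_coeff p"
      using False less.prems by (auto simp: m_def degree_monom_eq)
    have p': "p' \<in> PR" using m less.prems lr assms by (auto simp: p'_def)
    have dm: "degree (m * r) = degree p" using degree_mult_PR[of m r] m assms False by simp
    have dp: "degree (smult (lead_coeff r) p) = degree p" using less.prems lr by (simp add: degree_smult_PR)
    have lc: "coeff (m * r) (degree p) = lead_coeff p * lead_coeff r"
      using lead_coeff_mult_PR[of m r] m assms dm by simp
    have "degree p' \<le> degree p" unfolding p'_def by (rule degree_diff_le) (simp_all only: dm dp order_refl)
    moreover have "coeff p' (degree p) = 0" using lc by (simp add: p'_def)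
    ultimately have "p' = 0 \<or> degree p' < degree p"
      using le_neq_implies_less leading_coeff_0_iff by metis
    then have "\<exists>c q t. c \<in> R \<and> c \<noteq> 0 \<and> q \<in> PR \<and> t \<in> PR \<and> smult c p' = q * r + t
       \<and> (t = 0 \<or> degree t < degree r)"
    proof
      assume "p' = 0"
      then show ?thesis by (intro exI[of _ 1] exI[of _ 0] exI[of _ 0]) auto
    qed (use less.hyps p' in blast)
    then obtain c q t where c: "c \<in> R" "c \<noteq> 0" "q \<in> PR" "t \<in> PR" "smult c p' = q * r + t"
      "t = 0 \<or> degree t < degree r" by blast
    have "smult (c * lead_coeff r) p = (smult c m + q) * r + t"
      using c(5) by (simp add: p'_def smult_diff_right algebra_simps)
    moreover have "c * lead_coeff r \<noteq> 0" using no_zero_div[of c "lead_coeff r"] c lr by auto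
    ultimately show ?thesis using c lr m
      by (intro exI[of _ "c * lead_coeff r"] exI[of _ "smult c m + q"] exI[of _ t]) auto
  qed
qed

text \<open>
  An irreducible polynomial of positive degree that divides \<open>g\<close> over the field of fractions
  divides \<open>g\<close> already over \<open>R\<close>: the prime factors of the denominator \<open>c\<close> cannot divide \<open>f\<close>, so
  they divide the cofactor and can be cancelled one at a time.
\<close>

lemma clear_denominator:
  assumes f: "irreducible_in PR PN f" "degree f > 0"
    and "c \<in> R" "c \<noteq> 0" "g \<in> PR" "u \<in> PR" "smult c g = f * u"
  shows "dvd_in PR f g"
  using assms(3-7)
proof (induction c arbitrary: u rule: factor_induct)
  case (unit a b)
  have "smult b (smult a g) = g" by (metis unit(3) mult.commute smult_1_left smult_smult)
  then have "g = f * smult b u" using unit by (metis mult_smult_right)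
  then show ?case using unit by (auto simp: dvd_in_def intro!: bexI[of _ "smult b u"])
next
  case (irred q a)
  have fR: "f \<in> PR" and q: "q \<in> R" "q \<noteq> 0" "N q \<noteq> 0" using f irred by (auto simp: irreducible_in_def)
  have "f * u = smult q (smult a g)" using irred by (simp add: mult.commute)
  then have "(\<exists>r\<in>PR. f = smult q r) \<or> (\<exists>r\<in>PR. u = smult q r)"
    using const_prime[OF irred(1) fR, of u "smult a g"] irred by auto
  then show ?case
  proof (elim disjE bexE)
    fix r assume r: "r \<in> PR" "f = smult q r"
    then have "f = [:q:] * r" by simp
    then have "PN [:q:] = 0 \<or> PN r = 0" using f(1) q(1) r(1) by (metis irreducible_in_def PR_const)
    then have "PN r = 0" using q by simp
    moreover have "degree r = degree f" using r q by (simp add: degree_smult_PR)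
    ultimately show ?thesis using f by (simp add: poly_norm_def)
  next
    fix r assume r: "r \<in> PR" "u = smult q r"
    have "smult q (smult a g) = smult q (f * r)" using \<open>f * u = smult q (smult a g)\<close> r(2) by simp
    moreover have "smult a g \<in> PR" "f * r \<in> PR" using irred.hyps irred.prems fR r by auto
    ultimately have "smult a g = f * r" using smult_cancel_PR q by blast
    then show ?thesis using irred r by blast
  qed
qed

text \<open>
  A factorization over the field of fractions becomes one over \<open>R\<close> when the prime factors of the
  denominator \<open>c\<close> are distributed among the two factors.
\<close>

lemma gauss_split:
  assumes "c \<in> R" "c \<noteq> 0" "f \<in> PR" "f \<noteq> 0" "q \<in> PR" "r \<in> PR" "smult c f = q * r"
  shows "\<exists>q1 r1 s. q1 \<in> PR \<and> r1 \<in> PR \<and> s \<in> R \<and> f = q1 * r1 \<and> r = smult s r1"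
  using assms
proof (induction c arbitrary: q r rule: factor_induct)
  case (unit a b)
  have "smult b (smult a f) = f" by (metis unit(3) mult.commute smult_1_left smult_smult)
  then have "f = smult b q * r" using unit by (metis mult_smult_left)
  then show ?case using unit by (intro exI[of _ "smult b q"] exI[of _ r] exI[of _ 1]) auto
next
  case (irred p a)
  have p: "p \<in> R" "p \<noteq> 0" using irred by (auto simp: irreducible_in_def)
  have qr: "q * r = smult p (smult a f)" using irred by simp
  then have "(\<exists>t\<in>PR. q = smult p t) \<or> (\<exists>t\<in>PR. r = smult p t)"
    using const_prime[OF irred(1), of q r "smult a f"] irred by auto
  then show ?case
  proof (elim disjE bexE)
    fix t assume t: "t \<in> PR" "q = smult p t"
    have "smult p (smult a f) = smult p (t * r)" using qr t(2) by simp
    moreover have "smult a f \<in> PR" "t * r \<in> PR" using irred.hyps irred.prems t by auto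
    ultimately have "smult a f = t * r" using smult_cancel_PR p by blast
    then show ?thesis using irred t by blast
  next
    fix t assume t: "t \<in> PR" "r = smult p t"
    have "smult p (smult a f) = smult p (q * t)" using qr t(2) by simp
    moreover have "smult a f \<in> PR" "q * t \<in> PR" using irred.hyps irred.prems t by auto
    ultimately have "smult a f = q * t" using smult_cancel_PR p by blast
    then obtain q1 r1 s where "q1 \<in> PR" "r1 \<in> PR" "s \<in> R" "f = q1 * r1" "t = smult s r1"
      using irred t by blast
    then show ?thesis using t p
      by (intro exI[of _ q1] exI[of _ r1] exI[of _ "p * s"]) auto
  qed
qed

text \<open>
  In positive degree this is the Euclidean argument over the field of fractions, without that field: a
  nonzero combination \<open>r\<close> of \<open>f\<close> and \<open>g\<close> of least degree divides both up to constants. By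
  \<open>gauss_split\<close>, irreducibility leaves two cases. Either \<open>r\<close> is \<open>f\<close> up to constants, and then
  \<open>f\<close> divides \<open>g\<close>; or \<open>r\<close> is constant, and then \<open>f\<close> divides \<open>r * h\<close> and therefore \<open>h\<close>.
\<close>

lemma irreducible_prime_PR:
  assumes f: "irreducible_in PR PN f" and g: "g \<in> PR" and h: "h \<in> PR" and dvd: "dvd_in PR f (g * h)"
  shows "dvd_in PR f g \<or> dvd_in PR f h"
proof (cases "degree f = 0")
  case True
  then obtain q where q: "f = [:q:]" by (metis degree_eq_zeroE)
  have "irreducible_in R N q" unfolding irreducible_in_def
  proof (intro conjI ballI impI)
    fix a b assume "a \<in> R" "b \<in> R" "q = a * b"
    then have "f = [:a:] * [:b:]" "[:a:] \<in> PR" "[:b:] \<in> PR" by (auto simp: q)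
    then have "PN [:a:] = 0 \<or> PN [:b:] = 0" using f by (metis irreducible_in_def)
    then show "N a = 0 \<or> N b = 0" by simp
  qed (use f q in \<open>auto simp: irreducible_in_def\<close>)
  moreover obtain u where "u \<in> PR" "g * h = smult q u" using dvd q by (auto simp: dvd_in_def)
  ultimately show ?thesis using const_prime[of q g h u] g h q by (auto simp: dvd_in_def)
next
  case False
  then have d: "degree f > 0" by simp
  have fR: "f \<in> PR" "f \<noteq> 0" using f by (auto simp: irreducible_in_def)
  define J where "J = {a * f + b * g | a b. a \<in> PR \<and> b \<in> PR}"
  have J_PR: "J \<subseteq> PR" using fR g by (auto simp: J_def)
  have fJ: "f \<in> J" unfolding J_def by (rule CollectI, rule exI[of _ 1], rule exI[of _ 0]) auto
  have gJ: "g \<in> J" unfolding J_def by (rule CollectI, rule exI[of _ 0], rule exI[of _ 1]) auto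
  have J_comb: "smult c x - q * y \<in> J" if "x \<in> J" "y \<in> J" "c \<in> R" "q \<in> PR" for x y c q
  proof -
    obtain a b a' b' where "x = a * f + b * g" "y = a' * f + b' * g" "a \<in> PR" "b \<in> PR" "a' \<in> PR" "b' \<in> PR"
      using \<open>x \<in> J\<close> \<open>y \<in> J\<close> by (auto simp: J_def)
    then show ?thesis using that unfolding J_def
      by (intro CollectI exI[of _ "smult c a - q * a'"] exI[of _ "smult c b - q * b'"])
         (auto simp: algebra_simps smult_add_right)
  qed
  obtain r where r: "r \<in> J" "r \<noteq> 0" "\<And>s. s \<in> J \<Longrightarrow> s \<noteq> 0 \<Longrightarrow> degree r \<le> degree s"
    using ex_has_least_nat[of "\<lambda>r. r \<in> J \<and> r \<noteq> 0" f degree] fJ fR by auto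
  have rR: "r \<in> PR" using J_PR r(1) by blast
  \<comment> \<open>Minimality makes \<open>r\<close> a greatest common divisor up to constants.\<close>
  have div: "\<exists>c q. c \<in> R \<and> c \<noteq> 0 \<and> q \<in> PR \<and> smult c x = q * r" if x: "x \<in> J" for x
  proof -
    obtain c q t where cqt: "c \<in> R" "c \<noteq> 0" "q \<in> PR" "t \<in> PR" "smult c x = q * r + t"
        "t = 0 \<or> degree t < degree r"
      using pseudo_division[OF subsetD[OF J_PR x] rR r(2)] by blast
    have "t = smult c x - q * r" using cqt by simp
    then have "t \<in> J" using J_comb[OF x r(1) cqt(1,3)] by simp
    then have "t = 0" using r(3) cqt(6) by fastforce
    then show ?thesis using cqt by auto
  qed
  obtain c q where cq: "c \<in> R" "c \<noteq> 0" "q \<in> PR" "smult c f = q * r" using div[OF fJ] by blast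
  obtain c' q' where cq': "c' \<in> R" "c' \<noteq> 0" "q' \<in> PR" "smult c' g = q' * r" using div[OF gJ] by blast
  obtain q1 r1 s where qrs: "q1 \<in> PR" "r1 \<in> PR" "s \<in> R" "f = q1 * r1" "r = smult s r1"
    using gauss_split[OF cq(1,2) fR cq(3) rR cq(4)] by blast
  have "PN q1 = 0 \<or> PN r1 = 0" using f qrs(1,2,4) by (metis irreducible_in_def)
  then show ?thesis
  proof
    assume "PN q1 = 0"
    moreover have "q1 \<noteq> 0" using qrs fR by auto
    ultimately obtain v where v: "v \<in> PR" "q1 * v = 1" using PN_0_unit qrs by blast
    have "f * v = r1 * (q1 * v)" using qrs by (simp add: mult_ac)
    then have "r1 = f * v" using v by simp
    then have "smult c' g = f * (smult s (q' * v))" using cq' qrs by (simp add: mult_ac)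
    then show ?thesis using clear_denominator[OF f d cq'(1,2) g, of "smult s (q' * v)"] v cq' qrs by auto
  next
    assume "PN r1 = 0"
    then have "degree r1 = 0" by (simp add: poly_norm_def)
    then have "degree r = 0" using qrs(5) degree_smult_le[of s r1] by simp
    then obtain e where e: "r = [:e:]" by (metis degree_eq_zeroE)
    then have eR: "e \<in> R" "e \<noteq> 0" using rR r by auto
    obtain a b where ab: "a \<in> PR" "b \<in> PR" "r = a * f + b * g" using r(1) by (auto simp: J_def)
    obtain u where u: "u \<in> PR" "g * h = f * u" using dvd by (auto simp: dvd_in_def)
    have "smult e h = r * h" by (simp add: e)
    also have "\<dots> = f * (a * h) + b * (g * h)" by (simp add: ab algebra_simps)
    also have "\<dots> = f * (a * h + b * u)" by (simp add: u algebra_simps)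
    finally show ?thesis using clear_denominator[OF f d eR h, of "a * h + b * u"] ab h u by auto
  qed
qed

theorem normed_ufd_polys_over: "normed_ufd PR PN"
  by unfold_locales
     (use PR_no_zero_div PN_mult PN_0_unit irreducible_prime_PR in \<open>auto\<close>)

end

section \<open>Evaluation and expansion in one variable\<close>

lemma sum_single_lookup: "(\<Sum>t\<in>Poly_Mapping.keys p. Poly_Mapping.single t (Poly_Mapping.lookup p t)) = p"
  by (rule poly_mapping_eqI)
     (auto simp: lookup_sum lookup_single when_def in_keys_iff sum.delta')

definition mon_eval :: "('n::finite \<Rightarrow>\<^sub>0 nat) \<Rightarrow> real ^ 'n \<Rightarrow> real" where
  "mon_eval t x = (\<Prod>i\<in>UNIV. (x $ i) ^ Poly_Mapping.lookup t i)"

lemma mon_eval_0 [simp]: "mon_eval 0 x = 1"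
  by (simp add: mon_eval_def)

lemma mon_eval_add: "mon_eval (s + t) x = mon_eval s x * mon_eval t x"
  by (simp add: mon_eval_def lookup_add power_add prod.distrib)

lemma mon_eval_var [simp]: "mon_eval (Poly_Mapping.single j 1) x = x $ j"
proof -
  have "mon_eval (Poly_Mapping.single j 1) x = (\<Prod>i\<in>UNIV. if i = j then x $ j else 1)"
    unfolding mon_eval_def by (rule prod.cong) (auto simp: lookup_single when_def)
  then show ?thesis by simp
qed

lemma mpoly_eval_superset:
  assumes "finite T" "Poly_Mapping.keys p \<subseteq> T"
  shows "mpoly_eval p x = (\<Sum>t\<in>T. Poly_Mapping.lookup p t * mon_eval t x)"
  unfolding mpoly_eval_def mon_eval_def
  by (rule sum.mono_neutral_left) (use assms in \<open>auto simp: in_keys_iff\<close>)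

lemma mpoly_eval_0 [simp]: "mpoly_eval 0 x = 0"
  by (simp add: mpoly_eval_def)

lemma mpoly_eval_single [simp]: "mpoly_eval (Poly_Mapping.single t c) x = c * mon_eval t x"
  by (subst mpoly_eval_superset[of "{t}"]) auto

lemma mpoly_eval_1 [simp]: "mpoly_eval 1 x = 1"
  using mpoly_eval_single[of 0 1 x] by (simp del: mpoly_eval_single)

lemma mpoly_eval_add [simp]: "mpoly_eval (p + q) x = mpoly_eval p x + mpoly_eval q x"
proof -
  let ?T = "Poly_Mapping.keys p \<union> Poly_Mapping.keys q"
  have "mpoly_eval r x = (\<Sum>t\<in>?T. Poly_Mapping.lookup r t * mon_eval t x)" if "r \<in> {p, q, p + q}" for r
    using that keys_add[of p q] by (intro mpoly_eval_superset) auto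
  then show ?thesis by (simp add: lookup_add distrib_right sum.distrib)
qed

lemma mpoly_eval_sum: "mpoly_eval (sum h I) x = (\<Sum>i\<in>I. mpoly_eval (h i) x)"
  by (induction I rule: infinite_finite_induct) auto

lemma mpoly_eval_mult [simp]: "mpoly_eval (p * q) x = mpoly_eval p x * mpoly_eval q x"
proof -
  have "p * q = (\<Sum>s\<in>Poly_Mapping.keys p. \<Sum>t\<in>Poly_Mapping.keys q.
      Poly_Mapping.single (s + t) (Poly_Mapping.lookup p s * Poly_Mapping.lookup q t))"
    by (subst (1 2) sum_single_lookup[symmetric]) (simp add: sum_product mult_single)
  then have "mpoly_eval (p * q) x = (\<Sum>s\<in>Poly_Mapping.keys p. \<Sum>t\<in>Poly_Mapping.keys q.
      (Poly_Mapping.lookup p s * mon_eval s x) * (Poly_Mapping.lookup q t * mon_eval t x))"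
    by (simp add: mpoly_eval_sum mon_eval_add mult_ac)
  then show ?thesis
    using mpoly_eval_superset[OF finite_keys order_refl, of p x]
      mpoly_eval_superset[OF finite_keys order_refl, of q x]
    by (simp add: sum_product)
qed

lemma mpoly_eval_power [simp]: "mpoly_eval (p ^ k) x = mpoly_eval p x ^ k"
  by (induction k) auto

lemma mpoly_eval_prod: "mpoly_eval (prod h I) x = (\<Prod>i\<in>I. mpoly_eval (h i) x)"
  by (induction I rule: infinite_finite_induct) auto

lemma mpoly_eval_uminus [simp]: "mpoly_eval (- p) x = - mpoly_eval p x"
  using mpoly_eval_add[of p "- p" x] by (simp del: mpoly_eval_add)

lemma continuous_mpoly_eval: "continuous_on UNIV (mpoly_eval p)"
  unfolding mpoly_eval_def by (intro continuous_intros)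

definition var :: "'n \<Rightarrow> 'n rpoly" where
  "var j = Poly_Mapping.single (Poly_Mapping.single j 1) 1"

definition polys_in :: "'n set \<Rightarrow> 'n rpoly set" where
  "polys_in V = {p. \<forall>t\<in>Poly_Mapping.keys p. Poly_Mapping.keys t \<subseteq> V}"

lemma mpoly_eval_var [simp]: "mpoly_eval (var j) x = x $ j"
  using mon_eval_var[of j x] by (simp add: var_def)

lemma var_power: "var j ^ i = Poly_Mapping.single (Poly_Mapping.single j i) 1"
  by (induction i) (auto simp: var_def mult_single single_add[symmetric])

lemma polys_in_UNIV [simp]: "polys_in UNIV = UNIV"
  by (simp add: polys_in_def)

lemma polys_in_mono: "V \<subseteq> W \<Longrightarrow> polys_in V \<subseteq> polys_in W"
  by (auto simp: polys_in_def)

lemma polys_in_empty: "p \<in> polys_in {} \<longleftrightarrow> constant_poly p"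
proof
  assume "p \<in> polys_in {}"
  then have "Poly_Mapping.keys p \<subseteq> {0}" by (auto simp: polys_in_def)
  then have "p = Poly_Mapping.single 0 (Poly_Mapping.lookup p 0)"
    by (intro poly_mapping_eqI) (auto simp: lookup_single when_def in_keys_iff)
  then show "constant_poly p" by (auto simp: constant_poly_def)
qed (auto simp: polys_in_def constant_poly_def split: if_splits)

lemma single_in_polys_in: "Poly_Mapping.keys t \<subseteq> V \<Longrightarrow> Poly_Mapping.single t c \<in> polys_in V"
  by (auto simp: polys_in_def split: if_splits)

lemma polys_in_0: "0 \<in> polys_in V" and polys_in_1: "1 \<in> polys_in V"
  by (auto simp: polys_in_def)

lemma polys_in_add: "p \<in> polys_in V \<Longrightarrow> q \<in> polys_in V \<Longrightarrow> p + q \<in> polys_in V"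
  using keys_add[of p q] by (auto simp: polys_in_def)

lemma polys_in_uminus: "p \<in> polys_in V \<Longrightarrow> - p \<in> polys_in V"
  by (simp add: polys_in_def)

lemma polys_in_mult:
  assumes "p \<in> polys_in V" "q \<in> polys_in V"
  shows "p * q \<in> polys_in V"
  unfolding polys_in_def
proof (intro CollectI ballI)
  fix t assume "t \<in> Poly_Mapping.keys (p * q)"
  then obtain a b where "t = a + b" "a \<in> Poly_Mapping.keys p" "b \<in> Poly_Mapping.keys q"
    using keys_mult[of p q] by blast
  then show "Poly_Mapping.keys t \<subseteq> V"
    using keys_add[of a b] assms unfolding polys_in_def by blast
qed

lemma polys_in_sum: "(\<And>i. i \<in> I \<Longrightarrow> h i \<in> polys_in V) \<Longrightarrow> sum h I \<in> polys_in V"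
  by (induction I rule: infinite_finite_induct) (auto intro: polys_in_0 polys_in_add)

lemma polys_in_var_power: "j \<in> V \<Longrightarrow> var j ^ i \<in> polys_in V"
  unfolding var_power by (rule single_in_polys_in) (auto split: if_splits)

lemma mpoly_eval_polys_in_cong:
  fixes x y :: "real ^ 'n::finite"
  assumes "p \<in> polys_in V" "\<And>i. i \<in> V \<Longrightarrow> x $ i = y $ i"
  shows "mpoly_eval p x = mpoly_eval p y"
  unfolding mpoly_eval_def
proof (intro sum.cong refl arg_cong2[of _ _ _ _ "(*)"] prod.cong)
  fix t i assume "t \<in> Poly_Mapping.keys p"
  then have "Poly_Mapping.keys t \<subseteq> V" using assms by (auto simp: polys_in_def)
  then show "(x $ i) ^ Poly_Mapping.lookup t i = (y $ i) ^ Poly_Mapping.lookup t i"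
    using assms(2)[of i] not_in_keys_iff_lookup_eq_zero[of i t] by (cases "i \<in> V") auto
qed

lemma lookup_mult_single_add:
  fixes a :: "'n rpoly"
  shows "Poly_Mapping.lookup (a * Poly_Mapping.single s c) (t + s) = Poly_Mapping.lookup a t * c"
proof -
  have "a * Poly_Mapping.single s c
      = (\<Sum>r\<in>Poly_Mapping.keys a. Poly_Mapping.single (r + s) (Poly_Mapping.lookup a r * c))"
    by (subst sum_single_lookup[of a, symmetric]) (simp add: sum_distrib_right mult_single)
  then show ?thesis
    by (auto simp: lookup_sum lookup_single when_def in_keys_iff sum.delta')
qed

text \<open>
  Expansion in powers of the variable \<open>j\<close>: the terms of \<open>poly p (var j)\<close> in which \<open>j\<close> has exponent
  \<open>k\<close> come from the coefficient \<open>k\<close> of \<open>p\<close> alone, as no coefficient of \<open>p\<close> involves \<open>j\<close>.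
\<close>

lemma lookup_poly_var:
  assumes p: "p \<in> polys_over (polys_in V)" and j: "j \<notin> V" and t: "Poly_Mapping.lookup t j = 0"
  shows "Poly_Mapping.lookup (poly p (var j)) (t + Poly_Mapping.single j k) = Poly_Mapping.lookup (coeff p k) t"
proof -
  let ?u = "t + Poly_Mapping.single j k"
  have other: "Poly_Mapping.lookup (coeff p i * var j ^ i) ?u = 0" if "i \<noteq> k" for i
  proof (rule ccontr)
    assume "\<not> ?thesis"
    then have "?u \<in> Poly_Mapping.keys (coeff p i * var j ^ i)" by (simp add: in_keys_iff)
    then obtain r where r: "r \<in> Poly_Mapping.keys (coeff p i)" "?u = r + Poly_Mapping.single j i"
      using keys_mult[of "coeff p i" "var j ^ i"] by (auto simp: var_power)
    then have "j \<notin> Poly_Mapping.keys r" using p j by (auto simp: polys_over_def polys_in_def)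
    then have "Poly_Mapping.lookup (r + Poly_Mapping.single j i) j = i"
      by (simp add: lookup_add in_keys_iff)
    moreover have "Poly_Mapping.lookup ?u j = k" using t by (simp add: lookup_add)
    ultimately show False using that r(2) by simp
  qed
  have "Poly_Mapping.lookup (poly p (var j)) ?u
      = (\<Sum>i\<le>degree p. Poly_Mapping.lookup (coeff p i * var j ^ i) ?u)"
    by (simp add: poly_altdef lookup_sum)
  also have "\<dots> = (\<Sum>i\<le>degree p. if i = k then Poly_Mapping.lookup (coeff p k) t else 0)"
    by (rule sum.cong) (use other in \<open>auto simp: var_power lookup_mult_single_add\<close>)
  also have "\<dots> = Poly_Mapping.lookup (coeff p k) t" by (auto simp: coeff_eq_0)
  finally show ?thesis .
qed

lemma poly_var_eq_0:
  assumes p: "p \<in> polys_over (polys_in V)" and j: "j \<notin> V" and "poly p (var j) = 0"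
  shows "p = 0"
proof (intro poly_eqI poly_mapping_eqI)
  fix k t
  show "Poly_Mapping.lookup (coeff p k) t = Poly_Mapping.lookup (coeff 0 k) t"
  proof (cases "Poly_Mapping.lookup t j = 0")
    case True
    then show ?thesis using lookup_poly_var[OF p j True, of k] assms(3) by simp
  next
    case False
    then have "j \<in> Poly_Mapping.keys t" by (simp add: in_keys_iff)
    then have "t \<notin> Poly_Mapping.keys (coeff p k)" using p j
      unfolding polys_over_def polys_in_def by blast
    then show ?thesis by (simp add: in_keys_iff)
  qed
qed

text \<open>
  Together with \<open>poly_var_image\<close> this identifies the polynomials in the variables \<open>insert j V\<close> with
  the univariate polynomials whose coefficients are polynomials in the variables \<open>V\<close>. The
  induction on the number of variables and the partial derivatives below rest on it.
\<close>

lemma inj_on_poly_var: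
  assumes j: "j \<notin> V"
  shows "inj_on (\<lambda>p. poly p (var j)) (polys_over (polys_in V))"
proof (rule inj_onI)
  fix p q assume "p \<in> polys_over (polys_in V)" "q \<in> polys_over (polys_in V)" "poly p (var j) = poly q (var j)"
  moreover from this have "p - q \<in> polys_over (polys_in V)"
    using polys_in_add[OF _ polys_in_uminus] by (fastforce simp: polys_over_def)
  ultimately have "p - q = 0" using j by (intro poly_var_eq_0) auto
  then show "p = q" by simp
qed

lemma poly_var_image:
  assumes "j \<notin> V"
  shows "(\<lambda>p. poly p (var j)) ` polys_over (polys_in V) = polys_in (insert j V)"
proof (intro subset_antisym subsetI)
  fix q assume "q \<in> (\<lambda>p. poly p (var j)) ` polys_over (polys_in V)"
  then obtain p where p: "p \<in> polys_over (polys_in V)" "q = poly p (var j)" by blast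
  have "coeff p i \<in> polys_in (insert j V)" for i
    using p(1) polys_in_mono[of V "insert j V"] by (auto simp: polys_over_def)
  then show "q \<in> polys_in (insert j V)" unfolding p(2) poly_altdef
    by (intro polys_in_sum polys_in_mult polys_in_var_power) auto
next
  fix q assume q: "q \<in> polys_in (insert j V)"
  \<comment> \<open>Take the power of \<open>j\<close> out of each monomial of \<open>q\<close> and make it the power of the new variable.\<close>
  define lift where "lift t = monom (Poly_Mapping.single (t - Poly_Mapping.single j (Poly_Mapping.lookup t j))
        (Poly_Mapping.lookup q t)) (Poly_Mapping.lookup t j)" for t
  have term_in: "lift t \<in> polys_over (polys_in V)" if "t \<in> Poly_Mapping.keys q" for t
  proof -
    have "Poly_Mapping.keys t \<subseteq> insert j V" using that q by (auto simp: polys_in_def)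
    then have "Poly_Mapping.keys (t - Poly_Mapping.single j (Poly_Mapping.lookup t j)) \<subseteq> V"
      unfolding subset_iff in_keys_iff lookup_minus lookup_single when_def by auto
    then show ?thesis unfolding lift_def
      by (intro polys_overI) (auto intro: single_in_polys_in polys_in_0)
  qed
  have term_poly: "poly (lift t) (var j) = Poly_Mapping.single t (Poly_Mapping.lookup q t)" for t
  proof -
    have "t - Poly_Mapping.single j (Poly_Mapping.lookup t j) + Poly_Mapping.single j (Poly_Mapping.lookup t j) = t"
      by (rule poly_mapping_eqI) (auto simp: lookup_add lookup_minus lookup_single when_def)
    then show ?thesis by (simp add: lift_def poly_monom var_power mult_single)
  qed
  have "(\<Sum>t\<in>Poly_Mapping.keys q. lift t) \<in> polys_over (polys_in V)"
    using term_in by (intro polys_overI) (auto simp: coeff_sum polys_over_def intro!: polys_in_sum)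
  moreover have "poly (\<Sum>t\<in>Poly_Mapping.keys q. lift t) (var j) = q"
    by (simp add: poly_sum term_poly sum_single_lookup)
  ultimately show "q \<in> (\<lambda>p. poly p (var j)) ` polys_over (polys_in V)" by force
qed

lemma mpoly_eval_poly_var:
  "mpoly_eval (poly p (var j)) x = poly (map_poly (\<lambda>a. mpoly_eval a x) p) (x $ j)"
  by (induction p) (auto simp: map_poly_pCons)

section \<open>Unique factorization of real polynomials\<close>

text \<open>
  Transport along an isomorphism, here given as a ring homomorphism that is injective on the carrier.
\<close>

lemma normed_ufd_image:
  fixes h :: "'b::comm_ring_1 \<Rightarrow> 'a::comm_ring_1"
  assumes "normed_ufd S M"
    and hadd: "\<And>a b. h (a + b) = h a + h b" and hmult: "\<And>a b. h (a * b) = h a * h b"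
    and h1: "h 1 = 1" and inj: "inj_on h S"
  shows "normed_ufd (h ` S) (M \<circ> the_inv_into S h)"
proof -
  interpret S: normed_ufd S M by fact
  have h0: "h 0 = 0" using hadd[of 0 0] by simp
  have hneg: "h (- a) = - h a" for a using hadd[of a "- a"] h0 by (simp add: eq_neg_iff_add_eq_0 add.commute)
  have N: "(M \<circ> the_inv_into S h) (h a) = M a" if "a \<in> S" for a
    using the_inv_into_f_f[OF inj that] by simp
  have eq: "h a = h b \<longleftrightarrow> a = b" if "a \<in> S" "b \<in> S" for a b
    using inj that by (auto dest: inj_onD)
  have eq0: "h a = 0 \<longleftrightarrow> a = 0" if "a \<in> S" for a
    using eq[of a 0] that h0 by auto
  have dvd: "dvd_in (h ` S) (h a) (h b) \<longleftrightarrow> dvd_in S a b" if "a \<in> S" "b \<in> S" for a b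
    using that eq[of b] unfolding dvd_in_def by (auto simp: hmult[symmetric])
  show ?thesis
  proof
    show "0 \<in> h ` S" using S.zero_closed h0 by force
    show "1 \<in> h ` S" using S.one_closed h1 by force
    fix a b assume "a \<in> h ` S"
    then obtain x where x: "x \<in> S" "a = h x" by blast
    show "- a \<in> h ` S" using x by (auto simp: hneg[symmetric])
    show "\<exists>b\<in>h ` S. a * b = 1" if "a \<noteq> 0" "(M \<circ> the_inv_into S h) a = 0"
    proof -
      have "x \<noteq> 0" "M x = 0" using that x h0 N by auto
      then obtain y where "y \<in> S" "x * y = 1" using S.norm_0_unit x by blast
      then show ?thesis using x h1 by (intro bexI[of _ "h y"]) (auto simp: hmult[symmetric])
    qed
    assume "b \<in> h ` S"
    then obtain y where y: "y \<in> S" "b = h y" by blast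
    show "a + b \<in> h ` S" "a * b \<in> h ` S" using x y by (auto simp: hadd[symmetric] hmult[symmetric])
    show "a = 0 \<or> b = 0" if "a * b = 0"
    proof -
      have "x * y = 0" using that x y eq0[of "x * y"] by (simp add: hmult)
      then show ?thesis using S.no_zero_div[of x y] x y h0 by auto
    qed
    show "(M \<circ> the_inv_into S h) (a * b) = (M \<circ> the_inv_into S h) a + (M \<circ> the_inv_into S h) b"
      if "a \<noteq> 0" "b \<noteq> 0"
    proof -
      have "x \<noteq> 0" "y \<noteq> 0" using that x y h0 by auto
      then have "M (x * y) = M x + M y" using S.norm_mult x y by blast
      then show ?thesis using N[of x] N[of y] N[of "x * y"] x y by (simp only: hmult[symmetric] S.mult_closed)
    qed
    show "dvd_in (h ` S) q a \<or> dvd_in (h ` S) q b"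
      if q: "irreducible_in (h ` S) (M \<circ> the_inv_into S h) q" and d: "dvd_in (h ` S) q (a * b)" for q
    proof -
      obtain z where z: "z \<in> S" "q = h z" using q by (auto simp: irreducible_in_def)
      have "irreducible_in S M z" unfolding irreducible_in_def
      proof (intro conjI ballI impI)
        show "z \<noteq> 0" using q z h0 by (auto simp: irreducible_in_def)
        show "M z \<noteq> 0" using q z N[of z] by (auto simp: irreducible_in_def)
        fix c e assume ce: "c \<in> S" "e \<in> S" "z = c * e"
        then have "q = h c * h e" using z by (simp add: hmult)
        then have "(M \<circ> the_inv_into S h) (h c) = 0 \<or> (M \<circ> the_inv_into S h) (h e) = 0"
          using q imageI[OF ce(1), of h] imageI[OF ce(2), of h] by (metis irreducible_in_def)
        then show "M c = 0 \<or> M e = 0" using N ce by simp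
      qed (rule z)
      moreover have "dvd_in S z (x * y)" using d x y z dvd[of z "x * y"] by (simp add: hmult)
      ultimately have "dvd_in S z x \<or> dvd_in S z y" using S.irreducible_prime x y by blast
      then show ?thesis using dvd x y z by blast
    qed
  qed
qed

lemma constant_poly_0: "constant_poly 0"
  unfolding constant_poly_def by (intro exI[of _ 0]) simp

text \<open>
  The nonzero constants form the multiplicative group of a field, so none of them is irreducible.
\<close>

lemma normed_ufd_constants: "normed_ufd (polys_in {} :: 'n rpoly set) (\<lambda>_. 0)"
proof
  fix a :: "'n rpoly" assume a: "a \<in> polys_in {}"
  then obtain c where c: "a = Poly_Mapping.single 0 c" by (auto simp: polys_in_empty constant_poly_def)
  have "Poly_Mapping.single 0 c * Poly_Mapping.single 0 (1 / c) = (1 :: 'n rpoly)" if "c \<noteq> 0"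
    using that by (simp add: mult_single)
  then show "\<exists>b\<in>polys_in {}. a * b = 1" if "a \<noteq> 0"
    using that c by (cases "c = 0") (auto intro!: bexI[of _ "Poly_Mapping.single 0 (1 / c)"] single_in_polys_in)
  fix b :: "'n rpoly" assume "b \<in> polys_in {}"
  then obtain e where e: "b = Poly_Mapping.single 0 e" by (auto simp: polys_in_empty constant_poly_def)
  show "a = 0 \<or> b = 0" if "a * b = 0"
    using that unfolding c e mult_single by (metis add_0 lookup_single_eq lookup_zero mult_eq_0_iff single_zero)
qed (auto intro: polys_in_0 polys_in_1 polys_in_add polys_in_mult polys_in_uminus simp: irreducible_in_def)

text \<open>
  Gauss's lemma adds one variable at a time. The second conjunct keeps track of the units: only
  constants have norm zero.
\<close>

theorem normed_ufd_polys_in: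
  fixes V :: "'n set"
  assumes "finite V"
  shows "\<exists>N. normed_ufd (polys_in V :: 'n rpoly set) N \<and>
    (\<forall>a\<in>polys_in V. a \<noteq> 0 \<longrightarrow> N a = 0 \<longrightarrow> constant_poly a)"
  using assms
proof (induction V rule: finite_induct)
  case empty
  show ?case using normed_ufd_constants polys_in_empty by (intro exI[of _ "\<lambda>_. 0"]) blast
next
  case (insert j V)
  then obtain N where N: "normed_ufd (polys_in V :: 'n rpoly set) N"
      "\<And>a. a \<in> polys_in V \<Longrightarrow> a \<noteq> 0 \<Longrightarrow> N a = 0 \<Longrightarrow> constant_poly a" by blast
  let ?S = "polys_over (polys_in V)" and ?h = "\<lambda>p. poly p (var j)"
  have inj: "inj_on ?h ?S" using insert.hyps by (intro inj_on_poly_var)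
  have img: "?h ` ?S = polys_in (insert j V)" using insert.hyps by (intro poly_var_image)
  have "normed_ufd (?h ` ?S) (poly_norm N \<circ> the_inv_into ?S ?h)"
    by (rule normed_ufd_image[OF normed_ufd.normed_ufd_polys_over[OF N(1)]]) (use inj in auto)
  moreover have "constant_poly a"
    if a: "a \<in> ?h ` ?S" "a \<noteq> 0" "(poly_norm N \<circ> the_inv_into ?S ?h) a = 0" for a
  proof -
    obtain p where p: "p \<in> ?S" "a = ?h p" using a by blast
    then have "poly_norm N p = 0" using a the_inv_into_f_f[OF inj p(1)] by simp
    then have d: "degree p = 0" "N (lead_coeff p) = 0" by (auto simp: poly_norm_def)
    then have "a = lead_coeff p" using p(2) by (metis degree_eq_zeroE lead_coeff_pCons(2) mult_zero_right add.right_neutral poly_0 poly_pCons)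
    moreover have "lead_coeff p \<in> polys_in V" using p(1) by (auto simp: polys_over_def)
    ultimately show ?thesis using N(2)[of a] d a by simp
  qed
  ultimately show ?case unfolding img by blast
qed

lemma rpoly_norm:
  obtains N where "normed_ufd (UNIV :: 'n::finite rpoly set) N"
    "\<And>a :: 'n rpoly. a \<noteq> 0 \<Longrightarrow> N a = 0 \<longleftrightarrow> constant_poly a"
proof -
  obtain N where N: "normed_ufd (UNIV :: 'n rpoly set) N"
      "\<And>a :: 'n rpoly. a \<noteq> 0 \<Longrightarrow> N a = 0 \<Longrightarrow> constant_poly a"
    using normed_ufd_polys_in[of "UNIV :: 'n set"] by auto
  interpret normed_ufd "UNIV :: 'n rpoly set" N by (rule N)
  have "N a = 0" if a: "a \<noteq> 0" "constant_poly a" for a :: "'n rpoly"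
  proof -
    obtain c where c: "a = Poly_Mapping.single 0 c" using a(2) by (auto simp: constant_poly_def)
    then have "c \<noteq> 0" using a(1) by (cases "c = 0") auto
    then have "a * Poly_Mapping.single 0 (1 / c) = 1" using c by (simp add: mult_single)
    then show ?thesis using unit_norm_0[of a] by auto
  qed
  then have "N a = 0 \<longleftrightarrow> constant_poly a" if "a \<noteq> 0" for a :: "'n rpoly"
    using N(2) that by blast
  then show ?thesis by (rule that[OF N(1)])
qed

lemma rpoly_no_zero_div:
  fixes p q :: "'n::finite rpoly"
  assumes "p * q = 0"
  shows "p = 0 \<or> q = 0"
proof -
  obtain N where "normed_ufd (UNIV :: 'n rpoly set) N" by (rule rpoly_norm)
  then show ?thesis using normed_ufd.no_zero_div assms by blast
qed

lemma rpoly_mult_cancel: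
  fixes p q r :: "'n::finite rpoly"
  assumes "p \<noteq> 0" "p * q = p * r"
  shows "q = r"
  using rpoly_no_zero_div[of p "q - r"] assms by (simp add: algebra_simps)

lemma irreducible_poly_nonzero: "irreducible_poly f \<Longrightarrow> f \<noteq> 0"
  using constant_poly_0 by (auto simp: irreducible_poly_def)

lemma irreducible_poly_in:
  assumes N: "\<And>a :: 'n::finite rpoly. a \<noteq> 0 \<Longrightarrow> N a = (0::nat) \<longleftrightarrow> constant_poly a"
    and f: "irreducible_poly (f :: 'n rpoly)"
  shows "irreducible_in UNIV N f"
  unfolding irreducible_in_def
proof (intro conjI ballI impI)
  show "f \<noteq> 0" using f by (rule irreducible_poly_nonzero)
  then show "N f \<noteq> 0" using N f by (auto simp: irreducible_poly_def)
  fix a b assume "f = a * b"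
  moreover from this have "a \<noteq> 0" "b \<noteq> 0" using \<open>f \<noteq> 0\<close> by auto
  moreover have "constant_poly a \<or> constant_poly b" using f \<open>f = a * b\<close> unfolding irreducible_poly_def by blast
  ultimately show "N a = 0 \<or> N b = 0" using N by auto
qed simp

theorem irreducible_poly_prime:
  fixes f g h :: "'n::finite rpoly"
  assumes f: "irreducible_poly f" and dvd: "f dvd g * h"
  shows "f dvd g \<or> f dvd h"
proof -
  obtain N where N: "normed_ufd (UNIV :: 'n rpoly set) N"
    "\<And>a :: 'n rpoly. a \<noteq> 0 \<Longrightarrow> N a = 0 \<longleftrightarrow> constant_poly a"
    using rpoly_norm by blast
  have "dvd_in UNIV f g \<or> dvd_in UNIV f h"
    using normed_ufd.irreducible_prime[OF N(1) irreducible_poly_in[OF N(2) f]] dvd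
    by (auto simp: dvd_in_def dvd_def)
  then show ?thesis by (auto simp: dvd_in_def)
qed

lemma irreducible_poly_not_unit:
  fixes f :: "'n::finite rpoly"
  assumes f: "irreducible_poly f"
  shows "\<not> f dvd 1"
proof
  assume "f dvd 1"
  then obtain g where g: "f * g = 1" by (metis dvdE)
  obtain N where N: "normed_ufd (UNIV :: 'n rpoly set) N"
    "\<And>a :: 'n rpoly. a \<noteq> 0 \<Longrightarrow> N a = 0 \<longleftrightarrow> constant_poly a"
    using rpoly_norm by blast
  have "N f = 0" using normed_ufd.unit_norm_0[OF N(1) _ _ g] by simp
  then show False using irreducible_poly_in[OF N(2) f] by (auto simp: irreducible_in_def)
qed

lemma irreducible_poly_dvd_prod:
  fixes f :: "'n::finite rpoly"
  assumes f: "irreducible_poly f" and "f dvd prod h I"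
  shows "\<exists>i\<in>I. f dvd h i"
  using assms(2)
proof (induction I rule: infinite_finite_induct)
  case (insert i I)
  then show ?case using irreducible_poly_prime[OF f, of "h i" "prod h I"] by auto
qed (use irreducible_poly_not_unit[OF f] in auto)

text \<open>
  Splitting off a factor \<open>f\<close> lowers the norm, so repeated division by \<open>f\<close> ends.
\<close>

lemma multiplicity_exists:
  fixes f p :: "'n::finite rpoly"
  assumes f: "irreducible_poly f" and "p \<noteq> 0"
  obtains k q where "p = f ^ k * q" "\<not> f dvd q" "has_multiplicity f p k"
proof -
  obtain N where N: "normed_ufd (UNIV :: 'n rpoly set) N"
    "\<And>a :: 'n rpoly. a \<noteq> 0 \<Longrightarrow> N a = 0 \<longleftrightarrow> constant_poly a"
    using rpoly_norm by blast
  have f0: "f \<noteq> 0" and Nf: "N f \<noteq> 0"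
    using irreducible_poly_in[OF N(2) f] by (auto simp: irreducible_in_def)
  have "\<exists>k q. p = f ^ k * q \<and> \<not> f dvd q" using \<open>p \<noteq> 0\<close>
  proof (induction "N p" arbitrary: p rule: less_induct)
    case less
    show ?case
    proof (cases "f dvd p")
      case False
      then show ?thesis by (intro exI[of _ 0] exI[of _ p]) simp
    next
      case True
      then obtain r where r: "p = f * r" by blast
      then have "r \<noteq> 0" using less.prems by auto
      then have "N r < N p" using normed_ufd.norm_mult[OF N(1), of f r] f0 Nf r by simp
      then obtain k q where "r = f ^ k * q" "\<not> f dvd q" using less.hyps \<open>r \<noteq> 0\<close> by blast
      then show ?thesis using r by (intro exI[of _ "Suc k"] exI[of _ q]) (simp add: mult.assoc)
    qed
  qed
  then obtain k q where kq: "p = f ^ k * q" "\<not> f dvd q" by blast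
  have fk: "f ^ k \<noteq> 0" using kq \<open>p \<noteq> 0\<close> by auto
  have "\<not> f ^ (k + 1) dvd p"
  proof
    assume "f ^ (k + 1) dvd p"
    then obtain s where "f ^ k * q = f ^ (k + 1) * s" using kq(1) by (metis dvdE)
    then have "f ^ k * q = f ^ k * (f * s)" by (simp add: mult_ac)
    then have "q = f * s" using rpoly_mult_cancel[OF fk] by blast
    then show False using kq(2) by simp
  qed
  then have "has_multiplicity f p k" unfolding has_multiplicity_def using kq(1) by simp
  then show thesis using that kq by blast
qed

section \<open>Chains of prime ideals\<close>

text \<open>
  Bounding the degree in each variable separately makes the exponent vectors a cube, which is
  easy to count.
\<close>

definition deg_box :: "nat \<Rightarrow> 'n rpoly set" where
  "deg_box D = {p. \<forall>t\<in>Poly_Mapping.keys p. \<forall>i. Poly_Mapping.lookup t i \<le> D}"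

lemma deg_box_mono: "D \<le> D' \<Longrightarrow> deg_box D \<subseteq> deg_box D'"
  unfolding deg_box_def using le_trans by blast

lemma deg_box_exists:
  fixes p :: "'n::finite rpoly"
  shows "\<exists>D. p \<in> deg_box D"
proof -
  define D where "D = (\<Sum>t\<in>Poly_Mapping.keys p. \<Sum>i\<in>UNIV. Poly_Mapping.lookup t i)"
  have "Poly_Mapping.lookup t i \<le> D" if "t \<in> Poly_Mapping.keys p" for t i
  proof -
    have "Poly_Mapping.lookup t i \<le> (\<Sum>i\<in>UNIV. Poly_Mapping.lookup t i)"
      by (rule member_le_sum) auto
    also have "\<dots> \<le> D" unfolding D_def using that by (intro member_le_sum) auto
    finally show ?thesis .
  qed
  then show ?thesis by (auto simp: deg_box_def)
qed

lemma deg_box_1: "1 \<in> deg_box D"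
  by (auto simp: deg_box_def)

lemma deg_box_mult:
  assumes "p \<in> deg_box D" "q \<in> deg_box E"
  shows "p * q \<in> deg_box (D + E)"
  unfolding deg_box_def
proof (intro CollectI ballI allI)
  fix t i assume "t \<in> Poly_Mapping.keys (p * q)"
  then obtain a b where "t = a + b" "a \<in> Poly_Mapping.keys p" "b \<in> Poly_Mapping.keys q"
    using keys_mult[of p q] by blast
  then show "Poly_Mapping.lookup t i \<le> D + E"
    using assms unfolding deg_box_def by (auto simp: lookup_add intro!: add_mono)
qed

lemma deg_box_power:
  assumes "p \<in> deg_box D"
  shows "p ^ k \<in> deg_box (k * D)"
  by (induction k) (use assms deg_box_1 deg_box_mult in \<open>auto\<close>)

definition list_mon :: "'a::comm_ring_1 list \<Rightarrow> nat list \<Rightarrow> 'a" where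
  "list_mon xs es = prod_list (map2 (^) xs es)"

lemma list_mon_Nil [simp]: "list_mon [] es = 1"
  by (simp add: list_mon_def)

lemma list_mon_Cons [simp]: "list_mon (x # xs) (e # es) = x ^ e * list_mon xs es"
  by (simp add: list_mon_def)

lemma list_mon_deg_box:
  assumes "length es = length xs" "set xs \<subseteq> deg_box D" "\<forall>e\<in>set es. e \<le> N"
  shows "list_mon xs es \<in> deg_box (length xs * (N * D))"
  using assms
proof (induction xs arbitrary: es)
  case Nil
  then show ?case by (simp add: deg_box_1)
next
  case (Cons x xs es')
  then obtain e es where es': "es' = e # es" by (cases es') auto
  have "x ^ e \<in> deg_box (N * D)"
    using deg_box_power[of x D e] deg_box_mono[of "e * D" "N * D"] Cons.prems es' by auto
  then have "x ^ e * list_mon xs es \<in> deg_box (N * D + length xs * (N * D))"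
    using Cons es' by (intro deg_box_mult) auto
  then show ?case by (simp add: es')
qed

lemma card_exponent_box:
  "finite {t :: 'n::finite \<Rightarrow>\<^sub>0 nat. \<forall>i. Poly_Mapping.lookup t i \<le> M}"
  "card {t :: 'n::finite \<Rightarrow>\<^sub>0 nat. \<forall>i. Poly_Mapping.lookup t i \<le> M} \<le> (M + 1) ^ CARD('n)"
proof -
  let ?B = "{t :: 'n \<Rightarrow>\<^sub>0 nat. \<forall>i. Poly_Mapping.lookup t i \<le> M}"
  have inj: "inj_on Poly_Mapping.lookup ?B" by (auto intro: inj_onI poly_mapping_eqI)
  have sub: "Poly_Mapping.lookup ` ?B \<subseteq> (UNIV \<rightarrow>\<^sub>E {..M})" by (auto simp: PiE_def)
  have fin: "finite ((UNIV :: 'n set) \<rightarrow>\<^sub>E {..M})" by (intro finite_PiE) auto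
  show "finite ?B" using finite_imageD[OF finite_subset[OF sub fin] inj] .
  have "card ?B = card (Poly_Mapping.lookup ` ?B)" by (rule card_image[OF inj, symmetric])
  also have "\<dots> \<le> card ((UNIV :: 'n set) \<rightarrow>\<^sub>E {..M})" by (rule card_mono[OF fin sub])
  also have "\<dots> = (M + 1) ^ CARD('n)" by (simp add: card_PiE)
  finally show "card ?B \<le> (M + 1) ^ CARD('n)" .
qed

definition scalar :: "real \<Rightarrow> 'n rpoly \<Rightarrow> 'n rpoly" where
  "scalar c p = Poly_Mapping.single 0 c * p"

interpretation rpoly_vs: vector_space scalar
  by unfold_locales (simp_all add: scalar_def distrib_left distrib_right single_add mult_single mult.assoc[symmetric])

lemma deg_box_span:
  "deg_box D \<subseteq> rpoly_vs.span ((\<lambda>t. Poly_Mapping.single t 1) ` {t. \<forall>i. Poly_Mapping.lookup t i \<le> D})"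
proof
  fix p :: "'n rpoly" assume p: "p \<in> deg_box D"
  have "p = (\<Sum>t\<in>Poly_Mapping.keys p. scalar (Poly_Mapping.lookup p t) (Poly_Mapping.single t 1))"
    by (simp add: scalar_def mult_single sum_single_lookup)
  also have "\<dots> \<in> rpoly_vs.span ((\<lambda>t. Poly_Mapping.single t 1) ` {t. \<forall>i. Poly_Mapping.lookup t i \<le> D})"
    using p by (intro rpoly_vs.span_sum rpoly_vs.span_scale rpoly_vs.span_base) (auto simp: deg_box_def)
  finally show "p \<in> rpoly_vs.span ((\<lambda>t. Poly_Mapping.single t 1) ` {t. \<forall>i. Poly_Mapping.lookup t i \<le> D})" .
qed

text \<open>
  The family form of the exchange lemma; if two members coincide, their difference is the relation.
\<close>

lemma dependent_family:
  fixes v :: "'i \<Rightarrow> 'n rpoly"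
  assumes "finite I" "finite T" "card T < card I" "v ` I \<subseteq> rpoly_vs.span T"
  shows "\<exists>c. (\<exists>i\<in>I. c i \<noteq> 0) \<and> (\<Sum>i\<in>I. scalar (c i) (v i)) = 0"
proof (cases "inj_on v I")
  case True
  have "rpoly_vs.dependent (v ` I)"
  proof (rule ccontr)
    assume "\<not> ?thesis"
    then have "card (v ` I) \<le> card T"
      using rpoly_vs.independent_span_bound[OF assms(2) _ assms(4)] by blast
    then show False using card_image[OF True] assms(3) by simp
  qed
  then obtain u w where u: "w \<in> v ` I" "u w \<noteq> 0" "(\<Sum>w\<in>v ` I. scalar (u w) w) = 0"
    using rpoly_vs.dependent_finite[of "v ` I"] assms(1) by auto
  then show ?thesis using sum.reindex[OF True, of "\<lambda>w. scalar (u w) w"]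
    by (intro exI[of _ "u \<circ> v"]) auto
next
  case False
  then obtain a b where ab: "a \<in> I" "b \<in> I" "a \<noteq> b" "v a = v b" by (auto simp: inj_on_def)
  define c where "c i = (if i = a then 1 else if i = b then - 1 else 0 :: real)" for i
  have "(\<Sum>i\<in>I. scalar (c i) (v i)) = (\<Sum>i\<in>{a, b}. scalar (c i) (v i))"
    using assms(1) ab by (intro sum.mono_neutral_right) (auto simp: c_def scalar_def)
  also have "\<dots> = 0" using ab by (simp add: c_def scalar_def single_uminus)
  finally show ?thesis using ab by (intro exI[of _ c]) (auto simp: c_def)
qed

text \<open>
  With exponents up to \<open>N\<close> there are \<open>(N + 1) ^ (d + 1)\<close> monomials in the given \<open>d + 1\<close> polynomials,
  and they lie in a space of dimension at most \<open>(N * (d + 1) * D + 1) ^ d\<close>, where \<open>D\<close> bounds the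
  degrees. In \<open>N\<close> the first number has the larger order of growth, so the monomials are linearly
  dependent for large \<open>N\<close>.
\<close>

lemma algebraic_dependence:
  fixes xs :: "'n::finite rpoly list"
  assumes len: "length xs = CARD('n) + 1"
  obtains E c where "finite E" "E \<noteq> {}" "\<forall>e\<in>E. length e = length xs" "\<forall>e\<in>E. c e \<noteq> (0::real)"
    "(\<Sum>e\<in>E. Poly_Mapping.single 0 (c e) * list_mon xs e) = 0"
proof -
  let ?d = "CARD('n)"
  have "\<exists>D. set xs \<subseteq> deg_box D"
  proof (induction xs)
    case (Cons x xs)
    then obtain D where "set xs \<subseteq> deg_box D" by blast
    moreover obtain D' where "x \<in> deg_box D'" using deg_box_exists by blast
    ultimately show ?case
      using deg_box_mono[of D "max D D'"] deg_box_mono[of D' "max D D'"] by (intro exI[of _ "max D D'"]) auto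
  qed auto
  then obtain D where D: "set xs \<subseteq> deg_box D" by blast
  \<comment> \<open>With this \<open>N\<close>, \<open>(M + 1) ^ d \<le> ((N + 1) * K) ^ d = (N + 1) ^ d * N < (N + 1) ^ (d + 1)\<close>.\<close>
  define K where "K = (?d + 1) * D + 1"
  define N where "N = K ^ ?d"
  define I where "I = {es. set es \<subseteq> {..N} \<and> length es = ?d + 1}"
  define M where "M = (?d + 1) * (N * D)"
  define B where "B = {t :: 'n \<Rightarrow>\<^sub>0 nat. \<forall>i. Poly_Mapping.lookup t i \<le> M}"
  define T where "T = (\<lambda>t. Poly_Mapping.single t (1::real)) ` B"
  have I: "finite I" "card I = (N + 1) ^ (?d + 1)"
    unfolding I_def by (auto simp: finite_lists_length_eq card_lists_length_eq)
  have T: "finite T" "card T \<le> (M + 1) ^ ?d"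
    using card_exponent_box[where 'n = 'n, of M] card_image_le[of B "\<lambda>t. Poly_Mapping.single t (1::real)"]
    unfolding T_def B_def by auto
  have "M + 1 \<le> (N + 1) * K" unfolding M_def K_def by (simp add: algebra_simps)
  then have "(M + 1) ^ ?d \<le> ((N + 1) * K) ^ ?d" by (rule power_mono) simp
  also have "\<dots> = (N + 1) ^ ?d * N" by (simp only: power_mult_distrib N_def)
  also have "\<dots> < (N + 1) ^ ?d * (N + 1)" by simp
  also have "\<dots> = card I" using I by simp
  finally have card: "card T < card I" using T by simp
  have "list_mon xs ` I \<subseteq> rpoly_vs.span T"
  proof
    fix y assume "y \<in> list_mon xs ` I"
    then obtain es where es: "es \<in> I" "y = list_mon xs es" by blast
    have "list_mon xs es \<in> deg_box (length xs * (N * D))"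
      using es D len by (intro list_mon_deg_box) (auto simp: I_def)
    then show "y \<in> rpoly_vs.span T" using deg_box_span es len unfolding T_def B_def M_def by auto
  qed
  then obtain c where c: "\<exists>i\<in>I. c i \<noteq> 0" "(\<Sum>i\<in>I. scalar (c i) (list_mon xs i)) = 0"
    using dependent_family[OF I(1) T(1) card] by blast
  define E where "E = {e\<in>I. c e \<noteq> 0}"
  have "(\<Sum>e\<in>E. scalar (c e) (list_mon xs e)) = (\<Sum>e\<in>I. scalar (c e) (list_mon xs e))"
    unfolding E_def using I(1) by (intro sum.mono_neutral_left) (auto simp: scalar_def)
  then have "(\<Sum>e\<in>E. Poly_Mapping.single 0 (c e) * list_mon xs e) = 0"
    using c(2) by (simp add: scalar_def)
  moreover have "finite E" "E \<noteq> {}" "\<forall>e\<in>E. c e \<noteq> 0" using c(1) I(1) by (auto simp: E_def)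
  moreover have "\<forall>e\<in>E. length e = length xs" using len by (auto simp: E_def I_def)
  ultimately show ?thesis by (intro that) 
qed

text \<open>
  The counterpart of \<open>primeideal\<close> for the ring given by a type, free of carriers and record syntax.
\<close>

definition prime_ideal :: "'a::comm_ring_1 set \<Rightarrow> bool" where
  "prime_ideal P \<longleftrightarrow> 0 \<in> P \<and> (\<forall>a\<in>P. \<forall>b\<in>P. a + b \<in> P) \<and> (\<forall>a\<in>P. \<forall>b. a * b \<in> P) \<and> 1 \<notin> P \<and>
     (\<forall>a b. a * b \<in> P \<longrightarrow> a \<in> P \<or> b \<in> P)"

lemma prime_idealD:
  assumes "prime_ideal P"
  shows "0 \<in> P" "a \<in> P \<Longrightarrow> b \<in> P \<Longrightarrow> a + b \<in> P" "a \<in> P \<Longrightarrow> a * b \<in> P" "a \<in> P \<Longrightarrow> b * a \<in> P" "1 \<notin> P"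
    "a * b \<in> P \<Longrightarrow> a \<in> P \<or> b \<in> P"
  using assms unfolding prime_ideal_def by (auto simp: mult.commute)

lemma prime_ideal_diff: "prime_ideal P \<Longrightarrow> a \<in> P \<Longrightarrow> b \<in> P \<Longrightarrow> a - b \<in> P"
  using prime_idealD(2)[of P a "b * (- 1)"] prime_idealD(3)[of P b "- 1"] by simp

lemma prime_ideal_power: "prime_ideal P \<Longrightarrow> a ^ k \<in> P \<Longrightarrow> a \<in> P"
  by (induction k) (auto dest: prime_idealD)

text \<open>
  Suppose the given combination of monomials is a relation modulo \<open>P 0\<close>. Split off the lowest power \<open>x ^ n\<close> of the first element \<open>x\<close> from it. As \<open>x\<close> is not in the
  prime \<open>P 0\<close>, this power cancels modulo \<open>P 0\<close>; as \<open>x\<close> lies in \<open>P 1\<close>, all terms with a higher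
  power of \<open>x\<close> vanish modulo \<open>P 1\<close>. What remains is a relation in the other elements along the
  shorter chain. At the end a nonzero constant would have to lie in a prime ideal.
\<close>

lemma chain_independent:
  fixes xs :: "'n rpoly list"
  assumes "\<And>i. i \<le> length xs \<Longrightarrow> prime_ideal (P i)"
    and "\<And>i. i < length xs \<Longrightarrow> P i \<subseteq> P (Suc i)"
    and "\<And>i. i < length xs \<Longrightarrow> xs ! i \<in> P (Suc i) - P i"
    and "finite E" "E \<noteq> {}" "\<forall>e\<in>E. length e = length xs" "\<forall>e\<in>E. c e \<noteq> (0::real)"
  shows "(\<Sum>e\<in>E. Poly_Mapping.single 0 (c e) * list_mon xs e) \<notin> P 0"
  using assms
proof (induction xs arbitrary: P E c)
  case Nil
  then have E: "E = {[]}" by auto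
  have "Poly_Mapping.single 0 (c []) * Poly_Mapping.single 0 (1 / c []) = (1 :: 'n rpoly)"
    using Nil E by (simp add: mult_single)
  then have "Poly_Mapping.single 0 (c []) \<notin> P 0" using prime_idealD(3)[of "P 0" _ "Poly_Mapping.single 0 (1 / c [])"] prime_idealD(5) Nil(1)[of 0] by fastforce
  then show ?case by (simp add: E)
next
  case (Cons x xs)
  have P: "prime_ideal (P 0)" "prime_ideal (P 1)" "P 0 \<subseteq> P 1" "x \<in> P 1" "x \<notin> P 0"
    using Cons.prems(1)[of 0] Cons.prems(1)[of 1] Cons.prems(2,3)[of 0] by auto
  let ?t = "\<lambda>e. Poly_Mapping.single 0 (c e) * list_mon (x # xs) e"
  define n where "n = Min (hd ` E)"
  have n: "n \<in> hd ` E" "\<And>e. e \<in> E \<Longrightarrow> n \<le> hd e"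
    using Cons.prems(4,5) by (auto simp: n_def)
  have shape: "e = hd e # tl e" "length (tl e) = length xs" if "e \<in> E" for e
    using that Cons.prems(6) by (cases e; force)+
  \<comment> \<open>The terms with the lowest power of \<open>x\<close> give \<open>s0\<close>, the others are divisible by one more \<open>x\<close>.\<close>
  define E0 where "E0 = {e. n # e \<in> E}"
  define s0 where "s0 = (\<Sum>e\<in>E0. Poly_Mapping.single 0 (c (n # e)) * list_mon xs e)"
  define r where "r = (\<Sum>e\<in>{e\<in>E. hd e \<noteq> n}. Poly_Mapping.single 0 (c e) * (x ^ (hd e - n - 1) * list_mon xs (tl e)))"
  have E1: "{e\<in>E. hd e = n} = (#) n ` E0" using shape by (force simp: E0_def)
  have "(\<Sum>e\<in>E. ?t e) = (\<Sum>e\<in>{e\<in>E. hd e = n}. ?t e) + (\<Sum>e\<in>{e\<in>E. hd e \<noteq> n}. ?t e)"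
    by (subst sum.union_disjoint[symmetric]) (use Cons.prems(4) in \<open>auto intro!: sum.cong\<close>)
  also have "(\<Sum>e\<in>{e\<in>E. hd e = n}. ?t e) = x ^ n * s0"
    unfolding E1 s0_def by (subst sum.reindex) (auto simp: inj_on_def sum_distrib_left mult_ac)
  also have "(\<Sum>e\<in>{e\<in>E. hd e \<noteq> n}. ?t e) = x ^ n * (x * r)"
    unfolding r_def sum_distrib_left
  proof (rule sum.cong)
    fix e assume e: "e \<in> {e\<in>E. hd e \<noteq> n}"
    then have "n < hd e" using n(2)[of e] by simp
    then have "hd e = n + Suc (hd e - n - 1)" by simp
    then have "x ^ hd e = x ^ n * (x * x ^ (hd e - n - 1))" by (metis power_Suc power_add)
    moreover have "list_mon (x # xs) e = x ^ hd e * list_mon xs (tl e)"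
      using shape(1)[of e] e list_mon_Cons by (metis (no_types, lifting) mem_Collect_eq)
    ultimately show "?t e = x ^ n * (x * (Poly_Mapping.single 0 (c e) * (x ^ (hd e - n - 1) * list_mon xs (tl e))))"
      by (simp only: mult_ac)
  qed simp
  finally have sum: "(\<Sum>e\<in>E. ?t e) = x ^ n * (s0 + x * r)" by (simp add: distrib_left)
  have "finite ((#) n ` E0)" unfolding E1[symmetric] using Cons.prems(4) by simp
  then have finE0: "finite E0" by (rule finite_imageD) (auto simp: inj_on_def)
  obtain e0 where "e0 \<in> E" "hd e0 = n" using n(1) by blast
  then have E0_ne: "E0 \<noteq> {}" using E1 by blast
  have "s0 \<notin> P (Suc 0)" unfolding s0_def
  proof (rule Cons.IH[of "\<lambda>i. P (Suc i)" E0 "\<lambda>e. c (n # e)"])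
    show "prime_ideal (P (Suc i))" if "i \<le> length xs" for i using Cons.prems(1)[of "Suc i"] that by simp
    show "P (Suc i) \<subseteq> P (Suc (Suc i))" if "i < length xs" for i using Cons.prems(2)[of "Suc i"] that by simp
    show "xs ! i \<in> P (Suc (Suc i)) - P (Suc i)" if "i < length xs" for i
      using Cons.prems(3)[of "Suc i"] that by simp
    show "\<forall>e\<in>E0. length e = length xs" "\<forall>e\<in>E0. c (n # e) \<noteq> 0"
      using Cons.prems(6,7) by (auto simp: E0_def)
  qed (fact finE0 E0_ne)+
  then have s0: "s0 \<notin> P 1" by simp
  show ?case
  proof
    assume "(\<Sum>e\<in>E. ?t e) \<in> P 0"
    then have "s0 + x * r \<in> P 0"
      using sum P prime_ideal_power prime_idealD(6)[OF P(1)] by metis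
    then have "(s0 + x * r) - x * r \<in> P 1"
      using P by (intro prime_ideal_diff prime_idealD(3)) auto
    then show False using s0 by simp
  qed
qed

text \<open>
  The polynomial ring in \<open>d\<close> variables has Krull dimension at most \<open>d\<close>.
\<close>

theorem prime_chain_bound:
  fixes P :: "nat \<Rightarrow> 'n::finite rpoly set"
  assumes prime: "\<And>i. i \<le> CARD('n) + 1 \<Longrightarrow> prime_ideal (P i)"
    and strict: "\<And>i. i < CARD('n) + 1 \<Longrightarrow> P i \<subset> P (Suc i)"
  shows False
proof -
  have "\<forall>i. \<exists>x. i < CARD('n) + 1 \<longrightarrow> x \<in> P (Suc i) - P i" using strict by blast
  then obtain x where x: "\<And>i. i < CARD('n) + 1 \<Longrightarrow> x i \<in> P (Suc i) - P i" by metis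
  define xs where "xs = map x [0..<CARD('n) + 1]"
  have len: "length xs = CARD('n) + 1" by (simp add: xs_def)
  obtain E c where E: "finite E" "E \<noteq> {}" "\<forall>e\<in>E. length e = length xs" "\<forall>e\<in>E. c e \<noteq> (0::real)"
    "(\<Sum>e\<in>E. Poly_Mapping.single 0 (c e) * list_mon xs e) = 0"
    using algebraic_dependence[OF len] by blast
  have "(\<Sum>e\<in>E. Poly_Mapping.single 0 (c e) * list_mon xs e) \<notin> P 0"
  proof (rule chain_independent)
    show "xs ! i \<in> P (Suc i) - P i" if "i < length xs" for i
      using x[of i] that by (simp add: xs_def nth_append del: upt_Suc)
  qed (use E strict prime len in auto)
  then show False using E(5) prime_idealD(1)[OF prime[of 0]] by simp
qed

section \<open>Sign changes along an irreducible hypersurface\<close>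

text \<open>
  Expand \<open>f\<close> in a variable \<open>j\<close> that occurs in it and differentiate formally; the derivative \<open>g\<close> is
  nonzero in characteristic zero and has smaller degree in \<open>j\<close>, so it is no multiple of \<open>f\<close>.
\<close>

lemma irreducible_poly_partial_derivative:
  fixes f :: "'n::finite rpoly"
  assumes f: "irreducible_poly f"
  obtains g j where "\<not> f dvd g"
    "\<And>x. ((\<lambda>t. mpoly_eval f (\<chi> i. if i = j then t else x $ i)) has_real_derivative mpoly_eval g x) (at (x $ j))"
proof -
  have "f \<notin> polys_in {}" using f by (simp add: polys_in_empty irreducible_poly_def)
  then obtain t j where t: "t \<in> Poly_Mapping.keys f" "j \<in> Poly_Mapping.keys t"
    unfolding polys_in_def by blast
  define V where "V = - {j}"
  have j: "j \<notin> V" "insert j V = UNIV" by (auto simp: V_def)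
  have img: "q \<in> (\<lambda>p. poly p (var j)) ` polys_over (polys_in V)" for q
    using poly_var_image[OF j(1)] j(2) by simp
  obtain F where F: "F \<in> polys_over (polys_in V)" "f = poly F (var j)" using img[of f] by blast
  have d: "degree F > 0"
  proof (rule ccontr)
    assume "\<not> ?thesis"
    then obtain a where "F = [:a:]" by (metis degree_eq_zeroE gr0I)
    then have "f \<in> polys_in V" using F polys_over_def[of "polys_in V"] by (auto dest: spec[of _ 0])
    then show False using t j by (auto simp: polys_in_def)
  qed
  obtain N where "normed_ufd (polys_in V :: 'n rpoly set) N" using normed_ufd_polys_in[of V] by auto
  then interpret R: normed_ufd "polys_in V :: 'n rpoly set" N .
  \<comment> \<open>The derivative of \<open>F\<close> by its coefficients: \<open>pderiv\<close> asks for coefficients of a type without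
    zero divisors.\<close>
  define D where "D = (\<Sum>k<degree F. monom (of_nat (Suc k) * coeff F (Suc k)) k)"
  have D: "coeff D k = of_nat (Suc k) * coeff F (Suc k)" for k
    by (auto simp: D_def coeff_sum coeff_eq_0)
  have of_nat_in: "of_nat k \<in> polys_in V" for k
    by (induction k) (auto intro: polys_in_0 polys_in_1 polys_in_add)
  have DR: "D \<in> polys_over (polys_in V)"
    using F(1) of_nat_in by (intro polys_overI) (auto simp: D simp del: of_nat_Suc intro!: polys_in_mult)
  have "coeff D (degree F - 1) \<noteq> 0"
  proof
    assume "coeff D (degree F - 1) = 0"
    then have "of_nat (degree F) * lead_coeff F = 0" using d by (simp add: D del: of_nat_Suc)
    moreover have "of_nat (degree F) \<noteq> (0 :: 'n rpoly)" using d by simp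
    ultimately have "lead_coeff F = 0" using rpoly_no_zero_div by blast
    then show False using d by simp
  qed
  then have "D \<noteq> 0" by auto
  have dD: "degree D < degree F"
    using d by (intro degree_lessI) (auto simp: D coeff_eq_0)
  define g where "g = poly D (var j)"
  have "\<not> f dvd g"
  proof
    assume "f dvd g"
    then obtain h where "g = f * h" by blast
    moreover obtain H where H: "H \<in> polys_over (polys_in V)" "h = poly H (var j)" using img[of h] by blast
    ultimately have eq: "poly D (var j) = poly (F * H) (var j)" using F by (simp add: g_def)
    have DFH: "D = F * H"
      by (rule inj_onD[OF inj_on_poly_var[OF j(1)] eq DR R.PR_mult[OF F(1) H(1)]])
    then have "F \<noteq> 0" "H \<noteq> 0" using \<open>D \<noteq> 0\<close> by force+
    then have "degree D = degree F + degree H" using R.degree_mult_PR[OF F(1) H(1)] unfolding DFH by blast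
    then show False using dD by simp
  qed
  moreover have "((\<lambda>t. mpoly_eval f (\<chi> i. if i = j then t else x $ i)) has_real_derivative mpoly_eval g x) (at (x $ j))" for x
  proof -
    define u where "u = map_poly (\<lambda>a. mpoly_eval a x) F"
    have "mpoly_eval f (\<chi> i. if i = j then t else x $ i) = poly u t" for t
    proof -
      let ?y = "\<chi> i. if i = j then t else x $ i"
      have "mpoly_eval (coeff F k) ?y = mpoly_eval (coeff F k) x" for k
        by (rule mpoly_eval_polys_in_cong[OF R.coeff_in[OF F(1)]]) (use j(1) in auto)
      then have "map_poly (\<lambda>a. mpoly_eval a ?y) F = u" by (intro poly_eqI) (simp add: u_def coeff_map_poly)
      then show ?thesis unfolding F(2) mpoly_eval_poly_var by simp
    qed
    moreover have "mpoly_eval g x = poly (pderiv u) (x $ j)"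
    proof -
      have of_nat: "mpoly_eval (of_nat n) x = of_nat n" for n by (induction n) auto
      have "map_poly (\<lambda>a. mpoly_eval a x) D = pderiv u"
        by (intro poly_eqI) (simp add: u_def coeff_map_poly coeff_pderiv D of_nat del: of_nat_Suc)
      then show ?thesis unfolding g_def mpoly_eval_poly_var by simp
    qed
    ultimately show ?thesis by (simp add: poly_DERIV)
  qed
  ultimately show thesis using that by blast
qed

text \<open>
  Move along the coordinate axis \<open>j\<close>, on which \<open>f\<close> is strictly monotone at \<open>x\<close> to first order.
\<close>

lemma sign_change:
  fixes x :: "real ^ 'n::finite"
  assumes der: "((\<lambda>t. mpoly_eval f (\<chi> i. if i = j then t else x $ i)) has_real_derivative c) (at (x $ j))"
    and "c \<noteq> 0" and fx: "mpoly_eval f x = 0" and "\<delta> > 0"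
  shows "\<exists>y z. dist x y < \<delta> \<and> dist x z < \<delta> \<and> mpoly_eval f y > 0 \<and> mpoly_eval f z < 0"
proof -
  define Y where "Y t = (\<chi> i. if i = j then t else x $ i)" for t
  define h where "h t = sgn c * mpoly_eval f (Y t)" for t
  have Yx: "Y (x $ j) = x" by (simp add: Y_def vec_eq_iff)
  have dist: "dist x (Y (x $ j + s)) = \<bar>s\<bar>" for s
  proof -
    have "Y (x $ j + s) - x = s *\<^sub>R axis j 1" by (simp add: Y_def vec_eq_iff axis_def)
    then show ?thesis by (simp add: dist_norm norm_minus_commute[of x])
  qed
  have "(h has_real_derivative sgn c * c) (at (x $ j))"
    unfolding h_def Y_def by (rule DERIV_cmult[OF der])
  moreover have "sgn c * c > 0" using \<open>c \<noteq> 0\<close> by (simp add: sgn_if)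
  ultimately obtain d1 d2 where d: "d1 > 0" "\<And>s. 0 < s \<Longrightarrow> s < d1 \<Longrightarrow> h (x $ j) < h (x $ j + s)"
      "d2 > 0" "\<And>s. 0 < s \<Longrightarrow> s < d2 \<Longrightarrow> h (x $ j - s) < h (x $ j)"
    using DERIV_pos_inc_right[of h] DERIV_pos_inc_left[of h] by metis
  define s where "s = min \<delta> (min d1 d2) / 2"
  have s: "0 < s" "s < \<delta>" "s < d1" "s < d2" using d \<open>\<delta> > 0\<close> by (auto simp: s_def)
  have "h (x $ j) = 0" using fx by (simp add: h_def Yx)
  then have "sgn c * mpoly_eval f (Y (x $ j + s)) > 0" "sgn c * mpoly_eval f (Y (x $ j - s)) < 0"
    using d s by (auto simp: h_def)
  moreover have "dist x (Y (x $ j + s)) < \<delta>" "dist x (Y (x $ j - s)) < \<delta>"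
    using dist[of s] dist[of "- s"] s by auto
  ultimately show ?thesis using \<open>c \<noteq> 0\<close>
    by (cases "c > 0") (auto simp: sgn_if)
qed

text \<open>
  The polynomial \<open>g\<close> is a partial derivative of \<open>f\<close>: outside its zero set, some axis-parallel line
  through a zero of \<open>f\<close> crosses from negative to positive values of \<open>f\<close>. That \<open>f\<close> does not divide \<open>g\<close>
  guarantees that such points exist on every piece of \<open>Z(f)\<close> whose vanishing ideal is \<open>(f)\<close>.
\<close>

theorem irreducible_poly_sign_change:
  fixes f :: "'n::finite rpoly"
  assumes f: "irreducible_poly f"
  shows "\<exists>g. \<not> f dvd g \<and> (\<forall>x. mpoly_eval f x = 0 \<longrightarrow> mpoly_eval g x \<noteq> 0 \<longrightarrow> (\<forall>\<delta>>0.
      \<exists>y z. dist x y < \<delta> \<and> dist x z < \<delta> \<and> mpoly_eval f y > 0 \<and> mpoly_eval f z < 0))"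
proof (rule irreducible_poly_partial_derivative[OF f])
  fix g j
  assume g: "\<not> f dvd g"
    and der: "\<And>x. ((\<lambda>t. mpoly_eval f (\<chi> i. if i = j then t else x $ i)) has_real_derivative mpoly_eval g x)
      (at (x $ j))"
  show ?thesis by (intro exI[of _ g] conjI allI impI g sign_change[OF der])
qed

section \<open>Sets of codimension one\<close>

lemma primeideal_prime_ideal:
  "primeideal P (ring_of_type_algebra :: 'a::comm_ring_1 ring) \<Longrightarrow> prime_ideal P"
proof -
  assume "primeideal P (ring_of_type_algebra :: 'a ring)"
  then interpret primeideal P "ring_of_type_algebra :: 'a ring" .
  show ?thesis unfolding prime_ideal_def
    using additive_subgroup.zero_closed[OF additive_subgroup_axioms]
      additive_subgroup.a_closed[OF additive_subgroup_axioms] I_r_closed I_prime one_imp_carrier I_notcarr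
    by (auto simp: ring_of_type_algebra_def)
qed

lemma ideal_vanishing_ideal:
  "ideal (vanishing_ideal S) (ring_of_type_algebra :: 'n::finite rpoly ring)"
proof -
  interpret cring "ring_of_type_algebra :: 'n rpoly ring" by (rule cring_from_type_algebra)
  have minv: "\<ominus>\<^bsub>ring_of_type_algebra\<^esub> p = - p" for p :: "'n rpoly"
    by (rule minus_equality) (auto simp: ring_of_type_algebra_def)
  show ?thesis
  proof (rule idealI)
    show "subgroup (vanishing_ideal S) (add_monoid (ring_of_type_algebra :: 'n rpoly ring))"
      using minv
      by (intro add.subgroupI) (auto simp: ring_of_type_algebra_def vanishing_ideal_def a_inv_def intro: exI[of _ 0])
  qed (auto simp: ring_of_type_algebra_def vanishing_ideal_def ring_from_type_algebra[unfolded ring_of_type_algebra_def])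
qed

text \<open>
  The supremum in the definition of the dimension is attained: a bound by \<open>d - 2\<close> on the lengths of
  all chains would bound the supremum. The chain of primes of the quotient ring is pulled back along
  the projection.
\<close>

lemma sa_dim_chain:
  fixes S :: "(real ^ 'n::finite) set"
  assumes dim: "sa_dim S = ereal (real CARD('n) - 1)"
  obtains P where "\<And>i. i < CARD('n) \<Longrightarrow> prime_ideal (P i)" "\<And>i. Suc i < CARD('n) \<Longrightarrow> P i \<subset> P (Suc i)"
    "vanishing_ideal S \<subseteq> P 0"
proof -
  let ?R = "ring_of_type_algebra :: 'n rpoly ring" and ?I = "vanishing_ideal S" and ?d = "CARD('n)"
  let ?Q = "?R Quot ?I"
  interpret I: ideal ?I ?R by (rule ideal_vanishing_ideal)
  interpret R: cring ?R by (rule cring_from_type_algebra)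
  have carr: "carrier ?R = UNIV" by (simp add: ring_of_type_algebra_def)
  have "\<exists>n Q. n \<ge> ?d - 1 \<and> (\<forall>i\<le>n. primeideal (Q i) ?Q) \<and> (\<forall>i<n. Q i \<subset> Q (Suc i))"
  proof (rule ccontr)
    assume short: "\<not> ?thesis"
    have "sa_dim S \<le> ereal (real ?d - 2)"
      unfolding sa_dim_def krull_dim_def
    proof (rule Sup_least)
      fix z assume "z \<in> {ereal (real n) |n. \<exists>P. (\<forall>i\<le>n. primeideal (P i) ?Q) \<and> (\<forall>i<n. P i \<subset> P (Suc i))}"
      then obtain n where n: "z = ereal (real n)"
        "\<exists>P. (\<forall>i\<le>n. primeideal (P i) ?Q) \<and> (\<forall>i<n. P i \<subset> P (Suc i))" by blast
      then have "\<not> n \<ge> ?d - 1" using short by blast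
      then show "z \<le> ereal (real ?d - 2)" using n(1) by simp
    qed
    then show False using dim by simp
  qed
  then obtain n Q where n: "n \<ge> ?d - 1" and "\<forall>i\<le>n. primeideal (Q i) ?Q" "\<forall>i<n. Q i \<subset> Q (Suc i)"
    by blast
  then have Q: "\<And>i. i \<le> n \<Longrightarrow> primeideal (Q i) ?Q" "\<And>i. i < n \<Longrightarrow> Q i \<subset> Q (Suc i)" by auto
  define P where "P i = {p. ?I +>\<^bsub>?R\<^esub> p \<in> Q i}" for i
  have prime: "prime_ideal (P i)" if "i \<le> n" for i
    using ring_hom_ring.primeideal_vimage[OF I.rcos_ring_hom_ring R.is_cring Q(1)[OF that]] primeideal_prime_ideal
    by (simp add: P_def carr)
  have strict: "P i \<subset> P (Suc i)" if i: "i < n" for i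
  proof -
    obtain z where z: "z \<in> Q (Suc i)" "z \<notin> Q i" using Q(2)[OF i] by blast
    have "primeideal (Q (Suc i)) ?Q" using Q(1)[of "Suc i"] i by simp
    then have "additive_subgroup (Q (Suc i)) ?Q" by (intro ideal.axioms(1) primeideal.axioms(1))
    then have "z \<in> carrier ?Q" by (rule additive_subgroup.a_Hcarr) (rule z(1))
    then obtain p where "z = ?I +>\<^bsub>?R\<^esub> p" by (auto simp: FactRing_def A_RCOSETS_def')
    then show ?thesis using z Q(2)[OF i] by (auto simp: P_def)
  qed
  have "?I \<subseteq> P 0"
  proof
    fix p assume "p \<in> ?I"
    then have "?I +>\<^bsub>?R\<^esub> p = ?I" using I.a_rcos_const by simp
    moreover have "additive_subgroup (Q 0) ?Q" using Q(1)[of 0] by (intro ideal.axioms(1) primeideal.axioms(1)) simp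
    then have "\<zero>\<^bsub>?Q\<^esub> \<in> Q 0" by (rule additive_subgroup.zero_closed)
    ultimately show "p \<in> P 0" by (simp add: P_def FactRing_def)
  qed
  then show thesis using prime strict n by (intro that[of P]) auto
qed

text \<open>
  If the inclusion of \<open>(f)\<close> in the ideal of \<open>S\<close> were strict, \<open>0\<close> and \<open>(f)\<close> would prolong the chain
  of primes above the ideal of \<open>S\<close> beyond the Krull dimension of the polynomial ring.
\<close>

theorem vanishing_ideal_of_codim_1:
  fixes f :: "'n::finite rpoly" and S :: "(real ^ 'n) set"
  assumes f: "irreducible_poly f" and S: "S \<subseteq> zero_set f" and dim: "sa_dim S = ereal (real CARD('n) - 1)"
  shows "vanishing_ideal S = {h. f dvd h}"
proof (rule ccontr)
  assume neq: "vanishing_ideal S \<noteq> {h. f dvd h}"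
  have sub: "{h. f dvd h} \<subseteq> vanishing_ideal S"
    using S by (auto simp: vanishing_ideal_def zero_set_def elim!: dvdE)
  obtain P where P: "\<And>i. i < CARD('n) \<Longrightarrow> prime_ideal (P i)" "\<And>i. Suc i < CARD('n) \<Longrightarrow> P i \<subset> P (Suc i)"
    "vanishing_ideal S \<subseteq> P 0" using sa_dim_chain[OF dim] by blast
  define C where "C i = (if i = 0 then {0} else if i = 1 then {h. f dvd h} else P (i - 2))" for i :: nat
  have zero: "prime_ideal {0 :: 'n rpoly}"
    using rpoly_no_zero_div by (auto simp: prime_ideal_def)
  have prime: "prime_ideal {h. f dvd h}"
    unfolding prime_ideal_def mem_Collect_eq
  proof (intro conjI allI ballI impI)
    show "f dvd a \<or> f dvd b" if "f dvd a * b" for a b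
      using irreducible_poly_prime[OF f that] .
  qed (use irreducible_poly_not_unit[OF f] in \<open>auto intro: dvd_add dvd_mult2\<close>)
  have C0: "{0} \<subset> {h. f dvd h}"
  proof (rule psubsetI)
    have "f \<in> {h. f dvd h}" "f \<notin> {0}" using irreducible_poly_nonzero[OF f] by simp_all
    then show "{0} \<noteq> {h. f dvd h}" by metis
  qed simp
  have C1: "{h. f dvd h} \<subset> P 0" 
    by (rule psubset_subset_trans[OF psubsetI[OF sub neq[symmetric]] P(3)])
  have "C i \<subset> C (Suc i)" if "i < CARD('n) + 1" for i
  proof -
    consider "i = 0" | "i = 1" | k where "i = Suc (Suc k)" by (metis One_nat_def not0_implies_Suc)
    then show ?thesis
    proof cases
      case (3 k)
      then show ?thesis using P(2)[of k] that by (simp add: C_def)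
    qed (use C0 C1 in \<open>simp_all add: C_def\<close>)
  qed
  moreover have "prime_ideal (C i)" if "i \<le> CARD('n) + 1" for i
    using zero prime P(1)[of "i - 2"] that by (auto simp: C_def)
  ultimately show False using prime_chain_bound[of C] by blast
qed

section \<open>Boundaries of semi-algebraic sets\<close>

lemma bf_holds_cong: "(\<And>i. i \<in> bf_vars \<phi> \<Longrightarrow> v i = w i) \<Longrightarrow> bf_holds \<phi> v = bf_holds \<phi> w"
  by (induction \<phi>) auto

lemma eventually_sgn_mpoly_eval:
  assumes "mpoly_eval p x \<noteq> 0"
  shows "\<forall>\<^sub>F y in nhds x. sgn (mpoly_eval p y) = sgn (mpoly_eval p x)"
proof -
  have "isCont (mpoly_eval p) x"
    using continuous_mpoly_eval[of p] by (simp add: continuous_on_eq_continuous_at)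
  then have lim: "filterlim (mpoly_eval p) (nhds (mpoly_eval p x)) (nhds x)"
    unfolding isCont_def tendsto_at_iff_tendsto_nhds .
  show ?thesis
  proof (cases "mpoly_eval p x > 0")
    case True
    then have "\<forall>\<^sub>F y in nhds x. mpoly_eval p y > 0" using order_tendstoD(1)[OF lim] by blast
    then show ?thesis by eventually_elim (use True in simp)
  next
    case False
    then have neg: "mpoly_eval p x < 0" using assms by simp
    then have "\<forall>\<^sub>F y in nhds x. mpoly_eval p y < 0" using order_tendstoD(2)[OF lim] by blast
    then show ?thesis by eventually_elim (use neg in simp)
  qed
qed

lemma frontier_in_zero_sets:
  fixes p :: "nat \<Rightarrow> 'n::finite rpoly" and A :: "(real ^ 'n) set"
  assumes vars: "bf_vars \<Phi> \<subseteq> I" and "finite I"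
    and A: "A = {x. bf_holds \<Phi> (\<lambda>i. sgn (mpoly_eval (p i) x) \<in> E i)}"
  shows "frontier A \<subseteq> (\<Union>i\<in>I. zero_set (p i))"
proof (rule ccontr)
  assume "\<not> ?thesis"
  then obtain x where x: "x \<in> frontier A" "\<And>i. i \<in> I \<Longrightarrow> mpoly_eval (p i) x \<noteq> 0"
    by (auto simp: zero_set_def)
  have "\<forall>\<^sub>F y in nhds x. \<forall>i\<in>I. sgn (mpoly_eval (p i) y) = sgn (mpoly_eval (p i) x)"
    using \<open>finite I\<close> x(2) by (intro eventually_ball_finite ballI eventually_sgn_mpoly_eval) auto
  then have "\<forall>\<^sub>F y in nhds x. y \<in> A \<longleftrightarrow> x \<in> A"
  proof eventually_elim
    case (elim y)
    then show ?case unfolding A mem_Collect_eq using vars by (intro bf_holds_cong) auto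
  qed
  then obtain e where "e > 0" "\<And>y. dist y x < e \<Longrightarrow> y \<in> A \<longleftrightarrow> x \<in> A"
    by (auto simp: eventually_nhds_metric)
  then show False using x(1) unfolding frontier_straddle by (metis dist_commute)
qed

text \<open>
  The third and the fourth claim of the theorem differ only in whether \<open>A\<close> contains the zeros of \<open>f\<close> in
  the ball. The argument uses \<open>A\<close> only where \<open>f\<close> has a strict sign, so it covers both.
\<close>

lemma codim_1_piece_in_frontier:
  fixes f :: "'n::finite rpoly" and A :: "(real ^ 'n) set"
  assumes vars: "bf_vars \<Phi> \<subseteq> {1..m}"
    and A: "A = {x. bf_holds \<Phi> (\<lambda>i. sgn (mpoly_eval (p i) x) \<in> E i)}"
    and f: "irreducible_poly f"
    and dim: "sa_dim (zero_set f \<inter> ball a \<epsilon>) = ereal (real CARD('n) - 1)"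
    and pos: "\<And>y. y \<in> ball a \<epsilon> \<Longrightarrow> mpoly_eval f y > 0 \<Longrightarrow> y \<in> A"
    and neg: "\<And>y. y \<in> ball a \<epsilon> \<Longrightarrow> mpoly_eval f y < 0 \<Longrightarrow> y \<notin> A"
  shows "sa_dim (frontier A \<inter> zero_set f) = ereal (real CARD('n) - 1)
    \<and> (\<exists>i\<in>{1..m}. odd_multiplicity_factor f (p i))"
proof
  let ?S = "zero_set f \<inter> ball a \<epsilon>"
  have IS: "vanishing_ideal ?S = {h. f dvd h}"
    using vanishing_ideal_of_codim_1[OF f _ dim] by blast
  obtain g where g: "\<not> f dvd g"
    and sc: "\<forall>x. mpoly_eval f x = 0 \<longrightarrow> mpoly_eval g x \<noteq> 0 \<longrightarrow> (\<forall>\<delta>>0.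
      \<exists>y z. dist x y < \<delta> \<and> dist x z < \<delta> \<and> mpoly_eval f y > 0 \<and> mpoly_eval f z < 0)"
    using irreducible_poly_sign_change[OF f] by (elim exE conjE)
  have change: "\<exists>y z. y \<in> ball a \<epsilon> \<and> z \<in> ball a \<epsilon> \<and> dist x y < \<delta> \<and> dist x z < \<delta> \<and> mpoly_eval f y > 0 \<and> mpoly_eval f z < 0"
    if x: "x \<in> ?S" "mpoly_eval g x \<noteq> 0" and "\<delta> > 0" for x \<delta>
  proof -
    obtain r where r: "r > 0" "ball x r \<subseteq> ball a \<epsilon>" using x(1) by (meson IntD2 open_ball open_contains_ball)
    obtain y z where "dist x y < min r \<delta>" "dist x z < min r \<delta>" "mpoly_eval f y > 0" "mpoly_eval f z < 0"
      using sc[rule_format, OF _ x(2), of "min r \<delta>"] x(1) r(1) \<open>\<delta> > 0\<close> by (auto simp: zero_set_def)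
    then show ?thesis using r(2) by (intro exI[of _ y] exI[of _ z]) auto
  qed
  have frontier: "x \<in> frontier A" if x: "x \<in> ?S" "mpoly_eval g x \<noteq> 0" for x
    unfolding frontier_straddle
  proof (intro allI impI conjI)
    fix e :: real assume "e > 0"
    obtain y z where yz: "y \<in> ball a \<epsilon>" "z \<in> ball a \<epsilon>" "dist x y < e" "dist x z < e"
      "mpoly_eval f y > 0" "mpoly_eval f z < 0"
      using change[OF x \<open>e > 0\<close>] by metis
    show "\<exists>y\<in>A. dist x y < e" using pos[OF yz(1,5)] yz(3) by (rule bexI[rotated])
    show "\<exists>z. z \<notin> A \<and> dist x z < e" using neg[OF yz(2,6)] yz(4) by (intro exI[of _ z] conjI)
  qed
  \<comment> \<open>The dimension depends only on the vanishing ideal, so no dimension has to be computed.\<close>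
  have "vanishing_ideal (frontier A \<inter> zero_set f) = {h. f dvd h}"
  proof (intro subset_antisym subsetI)
    fix h assume h: "h \<in> vanishing_ideal (frontier A \<inter> zero_set f)"
    have "mpoly_eval h x * mpoly_eval g x = 0" if "x \<in> ?S" for x
      using frontier[OF that] h that unfolding vanishing_ideal_def by (cases "mpoly_eval g x = 0") auto
    then have "h * g \<in> vanishing_ideal ?S" by (simp add: vanishing_ideal_def)
    then have "f dvd h * g" by (simp add: IS)
    then show "h \<in> {h. f dvd h}" using irreducible_poly_prime[OF f, of h g] g by simp
  qed (auto simp: vanishing_ideal_def zero_set_def elim!: dvdE)
  then show "sa_dim (frontier A \<inter> zero_set f) = ereal (real CARD('n) - 1)"
    using dim IS unfolding sa_dim_def by simp
  show "\<exists>i\<in>{1..m}. odd_multiplicity_factor f (p i)"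
  proof (rule ccontr)
    assume no: "\<not> ?thesis"
    define I where "I = {i\<in>{1..m}. p i \<noteq> 0}"
    have "\<exists>q k. p i = f ^ k * q \<and> \<not> f dvd q \<and> even k" if "i \<in> I" for i
    proof -
      have "p i \<noteq> 0" "i \<in> {1..m}" using that by (auto simp: I_def)
      then obtain k q where kq: "p i = f ^ k * q" "\<not> f dvd q" "has_multiplicity f (p i) k"
        using multiplicity_exists[OF f] by metis
      have "even k"
      proof (rule ccontr)
        assume "odd k"
        then have "f dvd p i" unfolding kq(1) using dvd_mult2[OF dvd_power[of k f]] odd_pos by blast
        then have "odd_multiplicity_factor f (p i)"
          using f kq(3) \<open>odd k\<close> by (auto simp: odd_multiplicity_factor_def)
        then show False using no \<open>i \<in> {1..m}\<close> by blast
      qed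
      then show ?thesis using kq by blast
    qed
    then obtain q k where q: "\<And>i. i \<in> I \<Longrightarrow> p i = f ^ k i * q i" "\<And>i. i \<in> I \<Longrightarrow> \<not> f dvd q i"
      "\<And>i. i \<in> I \<Longrightarrow> even (k i)" by metis
    \<comment> \<open>As \<open>f\<close> is prime, \<open>g\<close> and all the \<open>q i\<close> are nonzero at a common zero of \<open>f\<close> in the ball.\<close>
    have "\<not> f dvd prod q I" using irreducible_poly_dvd_prod[OF f, of q I] q(2) by metis
    then have "\<not> f dvd prod q I * g" using irreducible_poly_prime[OF f, of "prod q I" g] g by metis
    then have "prod q I * g \<notin> vanishing_ideal ?S" by (simp add: IS)
    then obtain x where x: "x \<in> ?S" "mpoly_eval g x \<noteq> 0" "(\<Prod>i\<in>I. mpoly_eval (q i) x) \<noteq> 0"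
      by (auto simp: vanishing_ideal_def mpoly_eval_prod)
    have fin: "finite I" by (simp add: I_def)
    have qx: "mpoly_eval (q i) x \<noteq> 0" if "i \<in> I" for i
      using x(3) fin that by auto
    have "\<forall>\<^sub>F y in nhds x. \<forall>i\<in>I. sgn (mpoly_eval (q i) y) = sgn (mpoly_eval (q i) x)"
      using fin qx by (intro eventually_ball_finite ballI eventually_sgn_mpoly_eval) auto
    then obtain \<delta> where \<delta>: "\<delta> > 0"
      "\<And>y i. dist x y < \<delta> \<Longrightarrow> i \<in> I \<Longrightarrow> sgn (mpoly_eval (q i) y) = sgn (mpoly_eval (q i) x)"
      by (auto simp: eventually_nhds_metric dist_commute)
    obtain y z where yz: "y \<in> ball a \<epsilon>" "z \<in> ball a \<epsilon>" "dist x y < \<delta>" "dist x z < \<delta>"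
      "mpoly_eval f y > 0" "mpoly_eval f z < 0"
      using change[OF x(1,2) \<delta>(1)] by metis
    have sgn_p: "sgn (mpoly_eval (p i) w) = sgn (mpoly_eval (q i) x)"
      if "i \<in> I" "dist x w < \<delta>" "mpoly_eval f w \<noteq> 0" for i w
    proof -
      have "mpoly_eval f w ^ k i > 0" using q(3)[OF that(1)] that(3) by (simp add: zero_less_power_eq)
      then have "sgn (mpoly_eval f w ^ k i) = 1" by (rule sgn_pos)
      then have "sgn (mpoly_eval (p i) w) = sgn (mpoly_eval (q i) w)"
        by (simp only: q(1)[OF that(1)] mpoly_eval_mult mpoly_eval_power sgn_mult mult_1_left)
      then show ?thesis using \<delta>(2)[OF that(2,1)] by simp
    qed
    have "sgn (mpoly_eval (p i) y) = sgn (mpoly_eval (p i) z)" if "i \<in> {1..m}" for i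
    proof (cases "i \<in> I")
      case True
      then show ?thesis using sgn_p[of i y] sgn_p[of i z] yz by simp
    next
      case False
      then have "p i = 0" using that by (simp add: I_def)
      then show ?thesis by simp
    qed
    then have "y \<in> A \<longleftrightarrow> z \<in> A"
      unfolding A mem_Collect_eq using vars by (intro bf_holds_cong) auto
    then show False using pos[of y] neg[of z] yz by simp
  qed
qed

theorem theorem1p1:
  fixes m :: nat
    and p :: "nat \<Rightarrow> 'n::finite rpoly"
    and E :: "nat \<Rightarrow> real set"
    and \<Phi> :: bool_formula
    and A :: "(real ^ 'n) set"
    and f :: "'n rpoly"
  assumes "bf_vars \<Phi> \<subseteq> {1..m}"
    and "\<And>i. i \<in> {1..m} \<Longrightarrow> E i \<noteq> {} \<and> E i \<subseteq> {0, 1}"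
    and "A = {x. bf_holds \<Phi> (\<lambda>i. sgn (mpoly_eval (p i) x) \<in> E i)}"
    and "irreducible_poly f"
  shows
    "frontier A \<subseteq> (\<Union>i\<in>{1..m}. zero_set (p i))
   \<and> (sa_dim (frontier A \<inter> zero_set f) = ereal (real CARD('n) - 1) \<longrightarrow>
        (\<exists>i\<in>{1..m}. f dvd p i))
   \<and> ((\<exists>a\<in>zero_set f. \<exists>\<epsilon>>0.
          sa_dim (zero_set f \<inter> ball a \<epsilon>) = ereal (real CARD('n) - 1)
          \<and> nonneg_set f \<inter> ball a \<epsilon> = A \<inter> ball a \<epsilon>) \<longrightarrow>
        sa_dim (frontier A \<inter> zero_set f) = ereal (real CARD('n) - 1)
        \<and> (\<exists>i\<in>{1..m}. odd_multiplicity_factor f (p i)))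
   \<and> ((\<exists>a\<in>zero_set f. \<exists>\<epsilon>>0.
          sa_dim (zero_set f \<inter> ball a \<epsilon>) = ereal (real CARD('n) - 1)
          \<and> pos_set f \<inter> ball a \<epsilon> = A \<inter> ball a \<epsilon>) \<longrightarrow>
        sa_dim (frontier A \<inter> zero_set f) = ereal (real CARD('n) - 1)
        \<and> (\<exists>i\<in>{1..m}. odd_multiplicity_factor f (p i)))"
proof (intro conjI)
  show I: "frontier A \<subseteq> (\<Union>i\<in>{1..m}. zero_set (p i))"
    by (rule frontier_in_zero_sets[OF assms(1) _ assms(3)]) simp
  show "sa_dim (frontier A \<inter> zero_set f) = ereal (real CARD('n) - 1) \<longrightarrow> (\<exists>i\<in>{1..m}. f dvd p i)"
  proof
    assume "sa_dim (frontier A \<inter> zero_set f) = ereal (real CARD('n) - 1)"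
    then have "vanishing_ideal (frontier A \<inter> zero_set f) = {h. f dvd h}"
      using vanishing_ideal_of_codim_1[OF assms(4)] by blast
    moreover have "prod p {1..m} \<in> vanishing_ideal (frontier A \<inter> zero_set f)"
      using I by (auto simp: vanishing_ideal_def mpoly_eval_prod zero_set_def)
    ultimately have "f dvd prod p {1..m}" by blast
    then show "\<exists>i\<in>{1..m}. f dvd p i" by (rule irreducible_poly_dvd_prod[OF assms(4)])
  qed
  show "(\<exists>a\<in>zero_set f. \<exists>\<epsilon>>0.
          sa_dim (zero_set f \<inter> ball a \<epsilon>) = ereal (real CARD('n) - 1)
          \<and> nonneg_set f \<inter> ball a \<epsilon> = A \<inter> ball a \<epsilon>) \<longrightarrow>
        sa_dim (frontier A \<inter> zero_set f) = ereal (real CARD('n) - 1)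
        \<and> (\<exists>i\<in>{1..m}. odd_multiplicity_factor f (p i))"
  proof (intro impI, elim bexE exE conjE)
    fix a \<epsilon>
    assume dim: "sa_dim (zero_set f \<inter> ball a \<epsilon>) = ereal (real CARD('n) - 1)"
      and eq: "nonneg_set f \<inter> ball a \<epsilon> = A \<inter> ball a \<epsilon>"
    have "y \<in> A \<longleftrightarrow> mpoly_eval f y \<ge> 0" if "y \<in> ball a \<epsilon>" for y
      using that arg_cong[OF eq, of "\<lambda>B. y \<in> B"] by (simp add: nonneg_set_def)
    then show "sa_dim (frontier A \<inter> zero_set f) = ereal (real CARD('n) - 1)
        \<and> (\<exists>i\<in>{1..m}. odd_multiplicity_factor f (p i))"
      by (intro codim_1_piece_in_frontier[OF assms(1,3,4) dim]) auto
  qed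
  show "(\<exists>a\<in>zero_set f. \<exists>\<epsilon>>0.
          sa_dim (zero_set f \<inter> ball a \<epsilon>) = ereal (real CARD('n) - 1)
          \<and> pos_set f \<inter> ball a \<epsilon> = A \<inter> ball a \<epsilon>) \<longrightarrow>
        sa_dim (frontier A \<inter> zero_set f) = ereal (real CARD('n) - 1)
        \<and> (\<exists>i\<in>{1..m}. odd_multiplicity_factor f (p i))"
  proof (intro impI, elim bexE exE conjE)
    fix a \<epsilon>
    assume dim: "sa_dim (zero_set f \<inter> ball a \<epsilon>) = ereal (real CARD('n) - 1)"
      and eq: "pos_set f \<inter> ball a \<epsilon> = A \<inter> ball a \<epsilon>"
    have "y \<in> A \<longleftrightarrow> mpoly_eval f y > 0" if "y \<in> ball a \<epsilon>" for y
      using that arg_cong[OF eq, of "\<lambda>B. y \<in> B"] by (simp add: pos_set_def)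
    then show "sa_dim (frontier A \<inter> zero_set f) = ereal (real CARD('n) - 1)
        \<and> (\<exists>i\<in>{1..m}. odd_multiplicity_factor f (p i))"
      by (intro codim_1_piece_in_frontier[OF assms(1,3,4) dim]) auto
  qed
qed

end
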